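(* For every positive integer $v\equiv 3 \pmod 6$ with $v\notin\{3,9,45,75,129,513\}$, there exists a Steiner triple system of order $v$ whose chromatic index is at least $\frac{v+3}{2}$. For $v\in\{3,9\}$ no Steiner triple system of order $v$ has chromatic index at least $\frac{v+3}{2}$. (For $v\in\{45,75,129,513\}$ nothing is asserted.)
   Context: A Steiner triple system of order $v$ is a pair $(V,\mathcal{B})$ where $V$ is a set of $v$ points and $\mathcal{B}$ is a collection of $3$-subsets of $V$ (triples) such that any two distinct points occur together in exactly one triple. A partial parallel class is a set of pairwise disjoint triples of the system. The chromatic index of $(V,\mathcal{B})$ is the smallest number of partial parallel classes into which $\mathcal{B}$ can be partitioned; equivalently, the smallest number of colours needed to colour the triples so that no two distinct triples sharing a point receive the same colour. *)

theory Defs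
  imports Complex_Main "HOL-Library.Disjoint_Sets"
begin

definition steiner_triple_system :: "nat \<Rightarrow> 'a set \<Rightarrow> 'a set set \<Rightarrow> bool" where
  "steiner_triple_system v V B \<longleftrightarrow>
     finite V \<and> card V = v \<and>
     (\<forall>T\<in>B. T \<subseteq> V \<and> card T = 3) \<and>
     (\<forall>x\<in>V. \<forall>y\<in>V. x \<noteq> y \<longrightarrow> (\<exists>!T. T \<in> B \<and> x \<in> T \<and> y \<in> T))"

definition partial_parallel_class :: "'a set set \<Rightarrow> 'a set set \<Rightarrow> bool" where
  "partial_parallel_class B P \<longleftrightarrow> P \<subseteq> B \<and> disjoint P"

(* The blocks of a partition_on are nonempty; this does not affect the minimum.
   For a system of triples the minimum is attained, see chromatic_index_attained. *)
definition chromatic_index :: "'a set set \<Rightarrow> nat" where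
  "chromatic_index B =
     (LEAST k. \<exists>\<P>. partition_on B \<P> \<and> (\<forall>P\<in>\<P>. partial_parallel_class B P) \<and>
                   finite \<P> \<and> card \<P> = k)"

lemma steiner_triple_system_finite:
  assumes "steiner_triple_system v V B"
  shows "finite B"
proof (rule finite_subset)
  show "B \<subseteq> Pow V" "finite (Pow V)"
    using assms by (auto simp: steiner_triple_system_def)
qed

lemma chromatic_index_attained:
  assumes "finite B"
  shows "\<exists>\<P>. partition_on B \<P> \<and> (\<forall>P\<in>\<P>. partial_parallel_class B P) \<and>
             finite \<P> \<and> card \<P> = chromatic_index B"
  unfolding chromatic_index_def
proof (rule LeastI_ex)
  have "partition_on B ((\<lambda>T. {T}) ` B)"
    by (auto simp: partition_on_def disjoint_def)
  moreover have "\<forall>P\<in>(\<lambda>T. {T}) ` B. partial_parallel_class B P"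
    by (auto simp: partial_parallel_class_def disjoint_def)
  ultimately show "\<exists>k \<P>. partition_on B \<P> \<and> (\<forall>P\<in>\<P>. partial_parallel_class B P) \<and>
                     finite \<P> \<and> card \<P> = k"
    using assms by blast
qed

end

theory Submission
  imports Defs "HOL-Computational_Algebra.Primes"
begin

text \<open>
  In a Steiner triple system of order \<open>v\<close>, with \<open>v\<close> congruent to 3 modulo 6, there are \<open>v(v-1)/6\<close>
  blocks and a colour class has at most \<open>v/3\<close> of them, with equality exactly for a parallel class,
  one that covers every point. If \<open>(v+1)/2\<close> colours suffice, the total deficiency of the colour
  classes is only \<open>v/3\<close>, so at least \<open>(v+3)/6\<close> of them are parallel classes. It is therefore
  enough to construct systems with few pairwise disjoint parallel classes. In each construction
  below there is a small set \<open>S\<close> of blocks that every parallel class meets at least \<open>q\<close> times;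
  then pairwise disjoint parallel classes number at most \<open>|S|/q\<close> (lemma
  \<open>chromatic_index_lower_bound\<close>). The tool is always the same: weights are attached to the points,
  and the total weight of the points restricts which blocks a parallel class can consist of.

  If \<open>v\<close> is congruent to 15 modulo 18, Bose's system on three copies of a group of order \<open>v/3\<close>
  serves: integer weights on the three copies show that the number of vertical blocks in a
  parallel class is congruent to \<open>v/3\<close>, hence to 2, modulo 3, and there are only \<open>v/3\<close> vertical
  blocks. Order 21 is a product of the Fano plane with the integers modulo 3, in which one line is
  twisted.

  For every other order put \<open>n = v - 2\<close>, and take a cyclic group of order \<open>n\<close>, written here as the
  group of \<open>n\<close>-th roots of unity. The triples of distinct elements with product 1 form a partial
  system whose uncovered pairs are the pairs \<open>{x, x^-2}\<close> with \<open>x\<close> different from 1. Had these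
  pairs a proper colouring by two colours, each colour could be joined to its own point at
  infinity (the Schreiber--Wilson construction). The product of all group elements is 1, so in a
  parallel class the products of the two pairs joined to the points at infinity, unless these lie
  in one block, cancel: the pairs come from some \<open>x\<close> and from its inverse. If inverse elements get
  equal colours, this is impossible. Such a colouring exists on an orbit of squaring on the pairs
  \<open>{x, x^-1}\<close> when the orbit has even length. On each orbit of odd length one exchanges two
  triples for two others (locale \<open>switched_zero_sum\<close>); this restores the colouring at the cost of
  three special blocks per orbit. Together with the block through both points at infinity,
  \<open>3p + 1\<close> special blocks meet all parallel classes, where \<open>p\<close> is the number of odd orbits. The
  condition becomes \<open>18 p < n - 1\<close>. An orbit of odd length \<open>h\<close> consists of elements of order
  dividing \<open>2^h - 1\<close> or \<open>2^h + 1\<close>, so short odd orbits are rare. Lemma \<open>break_count\<close> shows that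
  the condition holds except possibly for \<open>n = 1, 7, 19, 31, 43, 73, 127, 511\<close>. The values 19 and
  31 belong to the orders 21 and 33, which the other constructions cover; the remaining ones
  belong to 3, to 9 and to the orders left open.

  Systems of order 3 have a single block. In a system of order 9 parallelism is an equivalence
  relation on the blocks, which yields a colouring with 4 colours.
\<close>

section \<open>Blocks and colourings\<close>

lemma sts_blockD:
  assumes "steiner_triple_system v V B" "T \<in> B"
  shows "T \<subseteq> V" "card T = 3" "finite T" "T \<noteq> {}"
proof -
  show "T \<subseteq> V" and c: "card T = 3" using assms by (auto simp: steiner_triple_system_def)
  show "finite T" using c by (intro card_ge_0_finite) simp
  show "T \<noteq> {}" using c by auto
qed

lemma sts_unique:
  assumes "steiner_triple_system v V B" "T \<in> B" "T' \<in> B"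
    "x \<in> T" "y \<in> T" "x \<in> T'" "y \<in> T'" "x \<noteq> y"
  shows "T = T'"
proof -
  have "x \<in> V" "y \<in> V" using sts_blockD(1)[OF assms(1,2)] assms by auto
  then have "\<exists>!T. T \<in> B \<and> x \<in> T \<and> y \<in> T"
    using assms by (simp add: steiner_triple_system_def)
  then show ?thesis using assms by blast
qed

lemma sts_star_card:
  assumes sts: "steiner_triple_system v V B" and q: "q \<in> V"
  shows "2 * card {T \<in> B. q \<in> T} = v - 1"
proof -
  let ?S = "{T \<in> B. q \<in> T}"
  have fin: "finite ?S" using steiner_triple_system_finite[OF sts] by simp
  have un: "(\<Union>T\<in>?S. T - {q}) = V - {q}"
  proof
    show "(\<Union>T\<in>?S. T - {q}) \<subseteq> V - {q}" using sts_blockD[OF sts] by blast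
    show "V - {q} \<subseteq> (\<Union>T\<in>?S. T - {q})"
      using sts q unfolding steiner_triple_system_def by blast
  qed
  have "card (\<Union>T\<in>?S. T - {q}) = (\<Sum>T\<in>?S. card (T - {q}))"
  proof (rule card_UN_disjoint[OF fin])
    show "\<forall>i\<in>?S. finite (i - {q})" using sts_blockD[OF sts] by blast
    show "\<forall>i\<in>?S. \<forall>j\<in>?S. i \<noteq> j \<longrightarrow> (i - {q}) \<inter> (j - {q}) = {}"
      using sts_unique[OF sts] by blast
  qed
  also have "\<dots> = (\<Sum>T\<in>?S. 2)"
    using sts_blockD[OF sts] by (intro sum.cong) auto
  finally show ?thesis
    using un q sts by (simp add: steiner_triple_system_def)
qed

lemma sts_card_blocks:
  assumes sts: "steiner_triple_system v V B"
  shows "6 * card B = v * (v - 1)"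
proof -
  have finB: "finite B" by (rule steiner_triple_system_finite[OF sts])
  have finV: "finite V" and cV: "card V = v" using sts by (auto simp: steiner_triple_system_def)
  have "3 * card B = (\<Sum>T\<in>B. card T)" using sts_blockD[OF sts] by simp
  also have "\<dots> = (\<Sum>T\<in>B. \<Sum>x\<in>V. if x \<in> T then 1 else 0)"
  proof (rule sum.cong[OF refl])
    fix T assume "T \<in> B"
    then have "V \<inter> T = T" using sts_blockD[OF sts] by blast
    then show "card T = (\<Sum>x\<in>V. if x \<in> T then 1 else 0)"
      using finV by (simp add: sum.If_cases)
  qed
  also have "\<dots> = (\<Sum>x\<in>V. \<Sum>T\<in>B. if x \<in> T then 1 else 0)" by (rule sum.swap)
  also have "\<dots> = (\<Sum>x\<in>V. card {T \<in> B. x \<in> T})"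
    using finB by (simp add: sum.If_cases Int_def)
  finally have "2 * (3 * card B) = (\<Sum>x\<in>V. 2 * card {T \<in> B. x \<in> T})"
    by (simp add: sum_distrib_left)
  also have "\<dots> = (\<Sum>x\<in>V. v - 1)"
    using sts_star_card[OF sts] by (intro sum.cong) auto
  finally show ?thesis using cV by simp
qed

lemma chromatic_index_le_card_colours:
  assumes fin: "finite B"
    and col: "\<And>T T'. \<lbrakk>T \<in> B; T' \<in> B; T \<noteq> T'; \<kappa> T = \<kappa> T'\<rbrakk> \<Longrightarrow> T \<inter> T' = {}"
  shows "chromatic_index B \<le> card (\<kappa> ` B)"
proof -
  let ?fib = "\<lambda>c. {T \<in> B. \<kappa> T = c}"
  let ?P = "?fib ` \<kappa> ` B"
  have "partition_on B ?P" by (auto simp: partition_on_def disjoint_def)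
  moreover have "\<forall>P\<in>?P. partial_parallel_class B P"
    using col by (auto simp: partial_parallel_class_def disjoint_def)
  moreover have "finite ?P" using fin by simp
  ultimately have "chromatic_index B \<le> card ?P"
    unfolding chromatic_index_def by (intro Least_le) blast
  also have "\<dots> \<le> card (\<kappa> ` B)" by (rule card_image_le) (use fin in simp)
  finally show ?thesis .
qed

section \<open>Orders 3 and 9\<close>

lemma chromatic_index_order_3:
  assumes "steiner_triple_system 3 V B"
  shows "chromatic_index B \<le> 1"
proof -
  have "card B = 1" using sts_card_blocks[OF assms] by simp
  moreover have "chromatic_index B \<le> card (id ` B)"
    by (rule chromatic_index_le_card_colours[OF steiner_triple_system_finite[OF assms]]) simp
  ultimately show ?thesis by simp
qed

text \<open>Four blocks pass through \<open>q\<close>, and three of them are spent on joining \<open>q\<close> to the points of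
  \<open>L\<close>.\<close>
lemma order_9_parallel:
  assumes sts: "steiner_triple_system 9 V B" and L: "L \<in> B" and q: "q \<in> V" "q \<notin> L"
  shows "\<exists>!T. T \<in> B \<and> q \<in> T \<and> T \<inter> L = {}"
proof -
  let ?S = "{T \<in> B. q \<in> T}" and ?M = "{T \<in> B. q \<in> T \<and> T \<inter> L \<noteq> {}}"
  have fin: "finite ?S" using steiner_triple_system_finite[OF sts] by simp
  have S: "card ?S = 4" using sts_star_card[OF sts q(1)] by simp
  have ex: "\<exists>T. T \<in> B \<and> q \<in> T \<and> x \<in> T" if "x \<in> L" for x
    using sts q L that sts_blockD(1)[OF sts L] unfolding steiner_triple_system_def
    by (metis subsetD)
  define l where "l x = (SOME T. T \<in> B \<and> q \<in> T \<and> x \<in> T)" for x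
  have l: "l x \<in> B" "q \<in> l x" "x \<in> l x" if "x \<in> L" for x
    using someI_ex[OF ex[OF that]] by (auto simp: l_def)
  have "inj_on l L"
  proof (rule inj_onI, rule ccontr)
    fix x y assume "x \<in> L" "y \<in> L" "l x = l y" "x \<noteq> y"
    then have "l x = L" using sts_unique[OF sts, of "l x" L x y] l L by metis
    then show False using l(2) q \<open>x \<in> L\<close> by blast
  qed
  moreover have "l ` L = ?M"
  proof
    show "l ` L \<subseteq> ?M" using l by blast
    show "?M \<subseteq> l ` L"
    proof
      fix T assume "T \<in> ?M"
      then obtain x where x: "x \<in> T" "x \<in> L" "T \<in> B" "q \<in> T" by blast
      then have "T = l x" using sts_unique[OF sts, of T "l x" q x] l q by metis
      then show "T \<in> l ` L" using x by blast
    qed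
  qed
  ultimately have M: "card ?M = 3" using sts_blockD[OF sts L] by (metis card_image)
  have "card (?S - ?M) = card ?S - card ?M"
    using fin by (intro card_Diff_subset) (auto intro: finite_subset[OF _ fin])
  also have "\<dots> = 1" using S M by simp
  finally obtain T where T: "?S - ?M = {T}" by (rule card_1_singletonE)
  then show ?thesis by (intro ex1I[of _ T]) blast+
qed

text \<open>Each block is coloured by the block through a fixed point \<open>p\<close> that is equal or parallel to
  it. Blocks with the same colour are disjoint by the uniqueness of parallels.\<close>
lemma chromatic_index_order_9:
  assumes sts: "steiner_triple_system 9 V B"
  shows "chromatic_index B \<le> 4"
proof -
  obtain p where p: "p \<in> V" using sts by (force simp: steiner_triple_system_def)
  define \<kappa> where "\<kappa> T = (if p \<in> T then T else THE L. L \<in> B \<and> p \<in> L \<and> L \<inter> T = {})" for T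
  have k: "\<kappa> T \<in> B \<and> p \<in> \<kappa> T \<and> (p \<notin> T \<longrightarrow> \<kappa> T \<inter> T = {})" if "T \<in> B" for T
    using theI'[OF order_9_parallel[OF sts that p]] that by (auto simp: \<kappa>_def)
  have "chromatic_index B \<le> card (\<kappa> ` B)"
  proof (rule chromatic_index_le_card_colours[OF steiner_triple_system_finite[OF sts]])
    fix T T' assume T: "T \<in> B" "T' \<in> B" "T \<noteq> T'" "\<kappa> T = \<kappa> T'"
    show "T \<inter> T' = {}"
    proof (cases "p \<in> T \<or> p \<in> T'")
      case True
      have "\<kappa> U = U" if "p \<in> U" for U using that by (simp add: \<kappa>_def)
      then show ?thesis using True k[OF T(1)] k[OF T(2)] T by (metis Int_commute)
    next
      case False
      show ?thesis
      proof (rule ccontr)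
        assume "T \<inter> T' \<noteq> {}"
        then obtain q where q: "q \<in> T" "q \<in> T'" by blast
        have "q \<notin> \<kappa> T" "q \<in> V" using k[OF T(1)] q False sts_blockD(1)[OF sts T(1)] by blast+
        then have "\<exists>!U. U \<in> B \<and> q \<in> U \<and> U \<inter> \<kappa> T = {}"
          using order_9_parallel[OF sts] k[OF T(1)] by blast
        moreover have "T \<inter> \<kappa> T = {}" "T' \<inter> \<kappa> T = {}" using k[OF T(1)] k[OF T(2)] T(4) False by auto
        ultimately show False using T q by blast
      qed
    qed
  qed
  also have "\<dots> \<le> card {L \<in> B. p \<in> L}"
    using k steiner_triple_system_finite[OF sts] by (intro card_mono) auto
  also have "\<dots> = 4" using sts_star_card[OF sts p] by simp
  finally show ?thesis .
qed

section \<open>Few disjoint parallel classes force many colours\<close>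

definition parallel_class :: "'a set \<Rightarrow> 'a set set \<Rightarrow> 'a set set \<Rightarrow> bool" where
  "parallel_class V B P \<longleftrightarrow> partial_parallel_class B P \<and> \<Union>P = V"

text \<open>This turns a weighting of the points into an equation for the blocks of a parallel class.
  All restrictions on parallel classes below come from it or from its multiplicative version.\<close>
lemma sum_parallel_class:
  assumes "steiner_triple_system v V B" "parallel_class V B P"
  shows "(\<Sum>T\<in>P. \<Sum>x\<in>T. w x) = (\<Sum>x\<in>V. w x :: 'b :: comm_monoid_add)"
proof -
  have "P \<subseteq> B" "disjoint P"
    using assms(2) by (auto simp: parallel_class_def partial_parallel_class_def)
  then have "sum w (\<Union>P) = (\<Sum>T\<in>P. sum w T)"
    using sts_blockD(3)[OF assms(1)]
    by (subst sum.Union_disjoint) (auto dest: disjointD)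
  then show ?thesis using assms by (simp add: parallel_class_def)
qed

text \<open>A colouring with at most \<open>(v+1)/2\<close> colours has at least \<open>(v+3)/6\<close> colour classes that are
  parallel classes, because any other class misses at least three points, \<open>v\<close> being divisible by
  3. These parallel classes are disjoint, so together they contain at least \<open>q (v+3)/6\<close> blocks of
  \<open>S\<close>.\<close>
lemma chromatic_index_lower_bound:
  assumes sts: "steiner_triple_system v V B" and v: "v mod 6 = 3"
    and S: "finite S" "6 * card S < q * (v + 3)"
    and hit: "\<And>P. parallel_class V B P \<Longrightarrow> q \<le> card (P \<inter> S)"
  shows "v + 3 \<le> 2 * chromatic_index B"
proof (rule ccontr)
  let ?k = "chromatic_index B"
  assume "\<not> ?thesis"
  then have k: "2 * ?k \<le> v + 1" using v by presburger
  have finB: "finite B" by (rule steiner_triple_system_finite[OF sts])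
  obtain \<P> where P: "partition_on B \<P>" "\<forall>P\<in>\<P>. partial_parallel_class B P" "finite \<P>"
    "card \<P> = ?k"
    using chromatic_index_attained[OF finB] by blast
  define D where "D = {P \<in> \<P>. \<Union>P = V}"
  have D: "D \<subseteq> \<P>" "finite D" using P by (auto simp: D_def)
  have finV: "finite V" and cV: "card V = v" using sts by (auto simp: steiner_triple_system_def)
  have finP: "finite P" "P \<subseteq> B" if "P \<in> \<P>" for P
    using that P finB by (auto simp: partial_parallel_class_def intro: finite_subset)
  have disj: "disjoint \<P>" using P by (simp add: partition_on_def)
  have size: "3 * card P + (if P \<in> D then 0 else 3) \<le> v" if "P \<in> \<P>" for P
  proof -
    have "card (\<Union>P) = (\<Sum>T\<in>P. card T)"
      using P(2) that finP(2)[OF that] sts_blockD(3)[OF sts]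
      by (intro card_Union_disjoint) (auto simp: partial_parallel_class_def dest: subsetD)
    also have "\<dots> = (\<Sum>T\<in>P. 3)" using finP[OF that] sts_blockD[OF sts] by (intro sum.cong) auto
    finally have c: "card (\<Union>P) = 3 * card P" by simp
    have sub: "\<Union>P \<subseteq> V" using finP[OF that] sts_blockD[OF sts] by blast
    then have "3 * card P \<le> v" using c cV card_mono[OF finV sub] by simp
    moreover have "3 * card P < v" if "P \<notin> D"
      using that \<open>P \<in> \<P>\<close> sub c cV psubset_card_mono[OF finV, of "\<Union>P"] by (auto simp: D_def)
    ultimately show ?thesis using v by (cases "P \<in> D"; simp; presburger)
  qed
  have "6 * q * card D \<le> 6 * card S"
  proof -
    have "q * card D = (\<Sum>P\<in>D. q)" by simp
    also have "\<dots> \<le> (\<Sum>P\<in>D. card (P \<inter> S))"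
      using P by (intro sum_mono hit) (auto simp: D_def parallel_class_def)
    also have "\<dots> = card (\<Union>P\<in>D. P \<inter> S)"
      using S D disj by (intro card_UN_disjoint[symmetric]) (auto simp: disjoint_def)
    also have "\<dots> \<le> card S" using S by (intro card_mono) auto
    finally show ?thesis by simp
  qed
  also have "6 * q * card D = q * (6 * card D)" by simp
  finally have "q * (6 * card D) < q * (v + 3)" using S(2) by (rule le_less_trans)
  then have cD: "6 * card D < v + 3" by simp
  have "card B = (\<Sum>P\<in>\<P>. card P)"
    using P(1) finP(1) card_Union_disjoint[of \<P>] by (auto simp: partition_on_def)
  then have "3 * card B = (\<Sum>P\<in>\<P>. 3 * card P)" by (simp add: sum_distrib_left)
  then have "3 * card B + 3 * (?k - card D) = (\<Sum>P\<in>\<P>. 3 * card P + (if P \<in> D then 0 else 3))"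
    using D P by (simp add: sum.distrib sum_distrib_left sum.If_cases Diff_eq[symmetric]
        card_Diff_subset
        Int_absorb1 mult.commute)
  also have "\<dots> \<le> (\<Sum>P\<in>\<P>. v)" by (rule sum_mono) (rule size)
  finally have le: "3 * card B + 3 * (?k - card D) \<le> ?k * v" using P by simp
  have "card D \<le> ?k" using card_mono[OF P(3) D(1)] P by simp
  then have "3 * int (card B) + 3 * (int ?k - int (card D)) \<le> int ?k * int v"
    using le by (simp flip: of_nat_mult of_nat_add of_nat_diff)
  moreover have "6 * int (card B) = int v * (int v - 1)"
    using arg_cong[OF sts_card_blocks[OF sts], of int] v by (cases v) (auto simp: algebra_simps)
  \<comment> \<open>Replacing the number of colours by its upper bound (v+1)/2 in the preceding inequality.\<close>
  moreover have "(int v + 1 - 2 * int ?k) * (int v - 3) \<ge> 0"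
    using k v by (intro mult_nonneg_nonneg) presburger+
  ultimately show False using cD by (simp add: algebra_simps)
qed

lemma sts_transport:
  assumes sts: "steiner_triple_system v V B" and inj: "inj_on \<phi> V"
  shows "steiner_triple_system v (\<phi> ` V) ((`) \<phi> ` B)"
proof -
  have sub: "\<And>T. T \<in> B \<Longrightarrow> T \<subseteq> V" using sts_blockD[OF sts] by blast
  have mem: "\<phi> x \<in> \<phi> ` T \<longleftrightarrow> x \<in> T" if "T \<in> B" "x \<in> V" for T x
    using inj_on_image_mem_iff[OF inj that(2) sub[OF that(1)]] .
  show ?thesis
    unfolding steiner_triple_system_def
  proof (intro conjI ballI impI)
    show "finite (\<phi> ` V)" "card (\<phi> ` V) = v"
      using sts inj by (auto simp: steiner_triple_system_def card_image)
    fix U assume "U \<in> (`) \<phi> ` B"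
    then obtain T where T: "T \<in> B" "U = \<phi> ` T" by blast
    show "U \<subseteq> \<phi> ` V" using T sub by blast
    show "card U = 3"
      using sts_blockD(2)[OF sts T(1)] card_image[OF inj_on_subset[OF inj sub[OF T(1)]]] T(2)
          by simp
  next
    fix a b assume "a \<in> \<phi> ` V" "b \<in> \<phi> ` V" "a \<noteq> b"
    then obtain x y where xy: "x \<in> V" "y \<in> V" "x \<noteq> y" and ab: "a = \<phi> x" "b = \<phi> y" by blast
    then obtain T where T: "T \<in> B" "x \<in> T" "y \<in> T" "\<And>T'. \<lbrakk>T' \<in> B; x \<in> T'; y \<in> T'\<rbrakk> \<Longrightarrow> T' = T"
      using sts unfolding steiner_triple_system_def by metis
    show "\<exists>!U. U \<in> (`) \<phi> ` B \<and> a \<in> U \<and> b \<in> U"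
    proof (rule ex1I[of _ "\<phi> ` T"])
      show "\<phi> ` T \<in> (`) \<phi> ` B \<and> a \<in> \<phi> ` T \<and> b \<in> \<phi> ` T" using T ab by blast
      fix U assume U: "U \<in> (`) \<phi> ` B \<and> a \<in> U \<and> b \<in> U"
      then obtain T' where T': "T' \<in> B" "U = \<phi> ` T'" by blast
      then have "x \<in> T'" "y \<in> T'" using U mem[OF T'(1)] xy ab by auto
      then show "U = \<phi> ` T" using T(4) T' by blast
    qed
  qed
qed

text \<open>The same criterion, with the system moved to the natural numbers.\<close>
lemma high_chromatic_index_nat:
  assumes sts: "steiner_triple_system v V B" and v: "v mod 6 = 3"
    and S: "finite S" "6 * card S < q * (v + 3)"
    and hit: "\<And>P. parallel_class V B P \<Longrightarrow> q \<le> card (P \<inter> S)"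
  shows "\<exists>(V::nat set) B. steiner_triple_system v V B \<and> real (chromatic_index B) \<ge> (real v + 3) / 2"
proof -
  have "finite V" using sts by (simp add: steiner_triple_system_def)
  then obtain \<phi> :: "'a \<Rightarrow> nat" where inj: "inj_on \<phi> V"
    using finite_imp_inj_to_nat_seg by blast
  have injB: "inj_on ((`) \<phi>) B"
    using inj sts_blockD(1)[OF sts] by (intro inj_onI) (metis inj_on_image_eq_iff)
  have disj: "\<phi> ` T \<inter> \<phi> ` T' = {} \<longleftrightarrow> T \<inter> T' = {}" if "T \<in> B" "T' \<in> B" for T T'
    using inj_on_image_Int[OF inj, of T T'] that sts_blockD(1)[OF sts] by auto
  let ?V = "\<phi> ` V" and ?B = "(`) \<phi> ` B" and ?S = "(`) \<phi> ` S"
  have sts': "steiner_triple_system v ?V ?B" by (rule sts_transport[OF sts inj])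
  have "v + 3 \<le> 2 * chromatic_index ?B"
  proof (rule chromatic_index_lower_bound[OF sts' v, of ?S])
    show "finite ?S" using S by simp
    show "6 * card ?S < q * (v + 3)" using S card_image_le[OF S(1), of "(`) \<phi>"] by linarith
    fix Q assume Q: "parallel_class ?V ?B Q"
    then have QB: "Q \<subseteq> ?B" and Qd: "disjoint Q" and QV: "\<Union>Q = ?V"
      by (auto simp: parallel_class_def partial_parallel_class_def)
    define P where "P = {T \<in> B. \<phi> ` T \<in> Q}"
    have im: "(`) \<phi> ` P = Q" using QB by (auto simp: P_def)
    have "disjoint P" unfolding disjoint_def
    proof (intro ballI impI)
      fix T T' assume T: "T \<in> P" "T' \<in> P" "T \<noteq> T'"
      then have "\<phi> ` T \<noteq> \<phi> ` T'" using injB by (auto simp: P_def inj_on_def)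
      then have "\<phi> ` T \<inter> \<phi> ` T' = {}" using T Qd by (auto simp: P_def disjoint_def)
      then show "T \<inter> T' = {}" using disj T by (auto simp: P_def)
    qed
    moreover have "\<Union>P = V"
    proof -
      have "\<Union>P \<subseteq> V" using sts_blockD(1)[OF sts] by (auto simp: P_def)
      moreover have "\<phi> ` \<Union>P = \<phi> ` V" using QV im by blast
      ultimately show ?thesis using inj by (metis inj_on_image_eq_iff order_refl)
    qed
    ultimately have "parallel_class V B P"
      by (auto simp: parallel_class_def partial_parallel_class_def P_def)
    from hit[OF this] have "q \<le> card ((`) \<phi> ` (P \<inter> S))"
      using injB by (subst card_image) (auto simp: P_def inj_on_def)
    also have "\<dots> \<le> card (Q \<inter> ?S)" using im S by (intro card_mono) auto
    finally show "q \<le> card (Q \<inter> ?S)" .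
  qed
  then have "real (v + 3) \<le> real (2 * chromatic_index ?B)" by (rule of_nat_mono)
  then have "(real v + 3) / 2 \<le> real (chromatic_index ?B)" by simp
  then show ?thesis using sts' by blast
qed

section \<open>Systems given by a third-point operation\<close>

text \<open>Two distinct points of a block determine the third one whichever two are chosen; conversely,
  such an operation defines a system. This reduces the existence of exactly one block through each
  pair to identities.\<close>
lemma steiner_triple_system_third:
  assumes V: "finite V" "card V = v"
    and third: "\<And>x y. \<lbrakk>x \<in> V; y \<in> V; x \<noteq> y\<rbrakk> \<Longrightarrow>
      t x y \<in> V \<and> t x y \<noteq> x \<and> t x y \<noteq> y \<and> t y x = t x y \<and> t x (t x y) = y"
  shows "steiner_triple_system v V {{x, y, t x y} | x y. x \<in> V \<and> y \<in> V \<and> x \<noteq> y}"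
    (is "steiner_triple_system v V ?B")
proof -
  have in_block: "T = {a, b, t a b}" if T: "T \<in> ?B" "a \<in> T" "b \<in> T" "a \<noteq> b" for T a b
  proof -
    obtain x y where xy: "T = {x, y, t x y}" "x \<in> V" "y \<in> V" "x \<noteq> y" using T by blast
    let ?z = "t x y"
    have z: "?z \<in> V" "?z \<noteq> x" "?z \<noteq> y" "t y x = ?z" "t x ?z = y" using third xy by auto
    have "t y ?z = x" using third[of y x] xy z by metis
    moreover have "t ?z x = y" "t ?z y = x"
      using third[of x ?z] third[of y ?z] xy z calculation by auto
    moreover have "(a, b) \<in> {(x, y), (y, x), (x, ?z), (?z, x), (y, ?z), (?z, y)}"
      using T xy z by auto
    ultimately show ?thesis using xy(1) z(4,5) by auto
  qed
  show ?thesis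
    unfolding steiner_triple_system_def
  proof (intro conjI ballI impI)
    show "finite V" "card V = v" by fact+
    fix T assume "T \<in> ?B"
    then obtain x y where xy: "T = {x, y, t x y}" "x \<in> V" "y \<in> V" "x \<noteq> y" by blast
    then show "T \<subseteq> V" "card T = 3" using third[of x y] by auto
  next
    fix x y assume xy: "x \<in> V" "y \<in> V" "x \<noteq> y"
    show "\<exists>!T. T \<in> ?B \<and> x \<in> T \<and> y \<in> T"
    proof (rule ex1I[of _ "{x, y, t x y}"])
      show "{x, y, t x y} \<in> ?B \<and> x \<in> {x, y, t x y} \<and> y \<in> {x, y, t x y}" using xy by blast
      show "T = {x, y, t x y}" if "T \<in> ?B \<and> x \<in> T \<and> y \<in> T" for T
        using in_block[of T x y] that xy by blast
    qed
  qed
qed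

section \<open>Order 21: a twisted product with the Fano plane\<close>

definition fano_sign :: "nat \<Rightarrow> nat \<Rightarrow> nat" where
  "fano_sign i j = (if i \<le> 3 \<and> j \<le> 3 then 1 else 0)"

text \<open>The numbers 1 to 7 with bitwise exclusive or are the points of the Fano plane, as nonzero
  vectors over the field of two elements. Each of them is multiplied by the integers modulo 3. The
  coordinates of a block over the line \<open>L\<close> add up to a constant modulo 3, which is 1 for the line
  \<open>{1,2,3}\<close> and 0 for all others. Without this twist the sum of all coordinates would give no
  information.\<close>
definition fano_third :: "nat \<times> nat \<Rightarrow> nat \<times> nat \<Rightarrow> nat \<times> nat" where
  "fano_third p q =
     (let (i, x) = p; (j, y) = q
      in if i = j then (i, 3 - x - y) else (Bit_Operations.xor i j, (fano_sign i j + 2 * x + 2 *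
          y) mod 3))"

definition fano_points :: "(nat \<times> nat) set" where
  "fano_points = {1..<8} \<times> {0..<3}"

definition fano_list :: "(nat \<times> nat) list" where
  "fano_list = List.product [1..<8] [0..<3]"

lemma fano_points_list: "fano_points = set fano_list"
  by (auto simp: fano_points_def fano_list_def)

lemma fano_third_laws:
  "\<forall>p\<in>set fano_list. \<forall>q\<in>set fano_list. p \<noteq> q \<longrightarrow> 
     (let r = fano_third p q in r \<in> set fano_list \<and> r \<noteq> p \<and> r \<noteq> q \<and> fano_third q p = r
         \<and> fano_third p r = q)"
  by code_simp

definition fano_lines :: "nat set list" where
  "fano_lines = [{1,2,3},{1,4,5},{1,6,7},{2,4,6},{2,5,7},{3,4,7},{3,5,6}]"

definition fano_blocks :: "(nat \<times> nat) set set" where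
  "fano_blocks = {{p, q, fano_third p q} | p q. p \<in> fano_points \<and> q \<in> fano_points \<and> p \<noteq> q}"

definition fano_verticals :: "(nat \<times> nat) set set" where
  "fano_verticals = (\<lambda>i. {i} \<times> {0..<3}) ` {1..<8}"

text \<open>Two distinct lines of the Fano plane share exactly one point; the sum counts the points that
  a line shares with the line through \<open>i\<close> and \<open>j\<close>.\<close>
lemma fano_lines_meet:
  "\<forall>i\<in>set [1..<8]. \<forall>j\<in>set [1..<8]. i \<noteq> j \<longrightarrow>
     (let k = Bit_Operations.xor i j in k \<noteq> i \<and> k \<noteq> j \<and>
       fano_sign i j = (if {i, j, k} = {1, 2, 3} then 1 else 0) \<and>
       (\<forall>L\<in>set fano_lines. of_bool (i \<in> L) + of_bool (j \<in> L) + of_bool (k \<in> L) =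
          (if {i, j, k} = L then 3 else 1 :: nat)))"
  by code_simp

lemma fano_line_avoiding:
  "\<forall>i\<in>set [1..<8]. \<exists>L\<in>set fano_lines. i \<notin> L"
  by code_simp

lemma fano_sts: "steiner_triple_system 21 fano_points fano_blocks"
  unfolding fano_blocks_def
proof (rule steiner_triple_system_third)
  show "finite fano_points" "card fano_points = 21" by (auto simp: fano_points_def)
  show "fano_third p q \<in> fano_points \<and> fano_third p q \<noteq> p \<and> fano_third p q \<noteq> q \<and>
      fano_third q p = fano_third p q \<and> fano_third p (fano_third p q) = q"
    if "p \<in> fano_points" "q \<in> fano_points" "p \<noteq> q" for p q
    using fano_third_laws that by (auto simp: fano_points_list Let_def)
qed

lemma fano_block_cases:
  assumes "T \<in> fano_blocks"
  obtains (vertical) i where "i \<in> {1..<8}" "T = {i} \<times> {0..<3}"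
  | (transversal) i j k x y z where "i \<in> {1..<8}" "j \<in> {1..<8}" "i \<noteq> j" "k = Bit_Operations.xor i j"
      "T = {(i, x), (j, y), (k, z)}" "z = (fano_sign i j + 2 * x + 2 * y) mod 3"
proof -
  obtain p q where pq: "T = {p, q, fano_third p q}" "p \<in> fano_points" "q \<in> fano_points" "p \<noteq> q"
    using assms by (auto simp: fano_blocks_def)
  obtain i x j y where ij: "p = (i, x)" "q = (j, y)" by force
  show thesis
  proof (cases "i = j")
    case True
    then have "x \<in> {0, 1, 2}" "y \<in> {0, 1, 2}" "x \<noteq> y"
      using pq ij by (auto simp: fano_points_def)
    then have "T = {i} \<times> {0..<3}"
      using True pq(1) by (auto simp: ij fano_third_def atLeast0_lessThan_Suc numeral_3_eq_3)
    then show ?thesis using vertical[of i] pq ij by (auto simp: fano_points_def)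
  next
    case False
    then show ?thesis
      using transversal[of i j "Bit_Operations.xor i j" x y] pq ij
      by (auto simp: fano_points_def fano_third_def)
  qed
qed

lemma fano_block_weights:
  assumes T: "T \<in> fano_blocks"
  shows "T \<in> fano_verticals \<Longrightarrow> (\<Sum>p\<in>T. snd p) = 3"
    and "T \<notin> fano_verticals \<Longrightarrow> (\<Sum>p\<in>T. snd p) mod 3 = of_bool (fst ` T = {1, 2, 3})"
    and "L \<in> set fano_lines \<Longrightarrow> (\<Sum>p\<in>T. of_bool (fst p \<in> L)) =
      (if T \<in> fano_verticals then 3 * of_bool (fst ` T \<subseteq> L) else 1 + 2 * of_bool (fst ` T = L) ::
          nat)"
proof -
  have "(T \<in> fano_verticals \<longrightarrow> (\<Sum>p\<in>T. snd p) = 3) \<and>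
     (T \<notin> fano_verticals \<longrightarrow> (\<Sum>p\<in>T. snd p) mod 3 = of_bool (fst ` T = {1, 2, 3})) \<and>
     (L \<in> set fano_lines \<longrightarrow> (\<Sum>p\<in>T. of_bool (fst p \<in> L)) =
      (if T \<in> fano_verticals then 3 * of_bool (fst ` T \<subseteq> L) else 1 + 2 * of_bool (fst ` T = L) ::
          nat))"
    using T
  proof (cases rule: fano_block_cases)
    case (vertical i)
    then have V: "T \<in> fano_verticals" "fst ` T = {i}" by (auto simp: fano_verticals_def)
    have T3: "T = {(i, 0), (i, 1), (i, 2)}"
      unfolding vertical(2) by (simp add: atLeast0_lessThan_Suc numeral_3_eq_3 numeral_2_eq_2
          insert_commute)
    have "(\<Sum>p\<in>T. snd p) = 3" "(\<Sum>p\<in>T. of_bool (fst p \<in> L)) = 3 * (of_bool (i \<in> L) :: nat)"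
      unfolding T3 by simp_all
    with V show ?thesis by simp
  next
    case (transversal i j k x y z)
    have "i \<in> set [1..<8]" "j \<in> set [1..<8]" using transversal(1,2) by simp_all
    then have "k \<noteq> i \<and> k \<noteq> j \<and> fano_sign i j = (if {i, j, k} = {1, 2, 3} then 1 else 0) \<and>
        (\<forall>L\<in>set fano_lines. of_bool (i \<in> L) + of_bool (j \<in> L) + of_bool (k \<in> L) =
          (if {i, j, k} = L then 3 else 1 :: nat))"
      using fano_lines_meet transversal(3) unfolding transversal(4) Let_def by blast
    then have k: "k \<noteq> i" "k \<noteq> j" "fano_sign i j = (if {i, j, k} = {1, 2, 3} then 1 else 0)"
      and L: "L \<in> set fano_lines \<Longrightarrow> of_bool (i \<in> L) + of_bool (j \<in> L) + of_bool (k \<in> L) =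
          (if {i, j, k} = L then 3 else 1 :: nat)"
      by blast+
    have fst_T: "fst ` T = {i, j, k}" by (simp add: transversal(5))
    then have "T \<notin> fano_verticals"
      using transversal(3) by (auto simp: fano_verticals_def fst_image_times)
    moreover have "(\<Sum>p\<in>T. snd p) = x + y + z" using k transversal(3) by (simp add: transversal(5))
    moreover have "(x + y + z) mod 3 = fano_sign i j"
    proof -
      have "(x + y + z) mod 3 = (fano_sign i j + 3 * (x + y)) mod 3"
        unfolding transversal(6) mod_add_right_eq by (simp add: algebra_simps)
      also have "\<dots> = fano_sign i j" unfolding mod_mult_self2 by (simp add: fano_sign_def)
      finally show ?thesis .
    qed
    moreover have "(\<Sum>p\<in>T. of_bool (fst p \<in> L)) = of_bool (i \<in> L) + of_bool (j \<in> L) + (of_bool (k \<in>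
        L) :: nat)"
      using k transversal(3) by (simp add: transversal(5))
    ultimately show ?thesis unfolding fst_T using L k(3) by simp
  qed
  then show "T \<in> fano_verticals \<Longrightarrow> (\<Sum>p\<in>T. snd p) = 3"
    and "T \<notin> fano_verticals \<Longrightarrow> (\<Sum>p\<in>T. snd p) mod 3 = of_bool (fst ` T = {1, 2, 3})"
    and "L \<in> set fano_lines \<Longrightarrow> (\<Sum>p\<in>T. of_bool (fst p \<in> L)) =
      (if T \<in> fano_verticals then 3 * of_bool (fst ` T \<subseteq> L) else 1 + 2 * of_bool (fst ` T = L) ::
          nat)"
    by blast+
qed

lemma sum_of_bool_card:
  assumes "finite A"
  shows "(\<Sum>x\<in>A. of_bool (Q x)) = card {x \<in> A. Q x}"
  using assms by (simp add: of_bool_def sum.If_cases Int_def)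

text \<open>Let \<open>D\<close> blocks of the parallel class be not vertical, and \<open>d(L)\<close> of them lie over the line
  \<open>L\<close>. Counting the nine points over \<open>L\<close> gives \<open>9 = 3 a + D + 2 d(L)\<close>, where \<open>a\<close> counts the
  vertical blocks over points of \<open>L\<close>. The coordinates add up to 21, so \<open>d({1,2,3})\<close> is divisible
  by 3, and hence so is \<open>D\<close>. If \<open>D\<close> were 6, a line that avoids the only vertical block would
  satisfy \<open>9 = 6 + 2 d(L)\<close>. As there are 7 blocks, \<open>D\<close> is at most 3.\<close>
lemma fano_parallel_class_verticals:
  assumes P: "parallel_class fano_points fano_blocks P"
  shows "4 \<le> card (P \<inter> fano_verticals)"
proof -
  let ?S = fano_verticals
  note tot = sum_parallel_class[OF fano_sts P]
  have PB: "P \<subseteq> fano_blocks" using P by (auto simp: parallel_class_def partial_parallel_class_def)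
  have fin: "finite P" using PB steiner_triple_system_finite[OF fano_sts] by (rule finite_subset)
  have split: "sum g P = sum g (P \<inter> ?S) + sum g (P - ?S)" for g :: "(nat \<times> nat) set \<Rightarrow> nat"
    using fin by (metis sum.Int_Diff)
  have "(\<Sum>T\<in>P. \<Sum>p\<in>T. 1) = (\<Sum>T\<in>P. 3 :: nat)"
    using PB sts_blockD(2)[OF fano_sts] by (intro sum.cong) auto
  moreover have "card fano_points = 21" by (simp add: fano_points_def)
  ultimately have "card P = 7" using tot[of "\<lambda>_. 1 :: nat"] by simp
  then have size: "card (P \<inter> ?S) + card (P - ?S) = 7" using card_Int_Diff[OF fin, of ?S] by simp
  have line: "9 = 3 * card {T \<in> P \<inter> ?S. fst ` T \<subseteq> L} + (card (P - ?S) + 2 * card {T \<in> P - ?S. fst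
      ` T = L})"
    if L: "L \<in> set fano_lines" for L
  proof -
    have "L \<subseteq> {1..<8}" "card L = 3" using L by (auto simp: fano_lines_def)
    have "(\<Sum>p\<in>fano_points. of_bool (fst p \<in> L)) = (\<Sum>i\<in>{1..<8}. \<Sum>x\<in>{0..<3::nat}. of_bool (i \<in> L) ::
        nat)"
      by (simp only: fano_points_def sum.cartesian_product case_prod_unfold)
    also have "\<dots> = 3 * (\<Sum>i\<in>{1..<8}. of_bool (i \<in> L))"
      by (simp only: sum_constant card_atLeastLessThan of_nat_id sum_distrib_left diff_zero)
    also have "\<dots> = 9"
      using \<open>L \<subseteq> {1..<8}\<close> \<open>card L = 3\<close> by (simp add: sum_of_bool_card Int_absorb1 flip: Int_def)
    finally have "9 = (\<Sum>T\<in>P. \<Sum>p\<in>T. of_bool (fst p \<in> L) :: nat)"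
      by (simp only: tot)
    also have "\<dots> = (\<Sum>T\<in>P \<inter> ?S. 3 * of_bool (fst ` T \<subseteq> L)) + (\<Sum>T\<in>P - ?S. 1 + 2 * of_bool (fst ` T =
        L))"
      unfolding split
    proof (intro arg_cong2[of _ _ _ _ "(+)"] sum.cong refl)
      fix T assume "T \<in> P \<inter> ?S"
      then show "(\<Sum>p\<in>T. of_bool (fst p \<in> L)) = (3 * of_bool (fst ` T \<subseteq> L) :: nat)"
        using fano_block_weights(3)[OF _ L, of T] PB by (simp only: if_True Int_iff subsetD)
    next
      fix T assume "T \<in> P - ?S"
      then show "(\<Sum>p\<in>T. of_bool (fst p \<in> L)) = (1 + 2 * of_bool (fst ` T = L) :: nat)"
        using fano_block_weights(3)[OF _ L, of T] PB by (simp only: if_False Diff_iff subsetD)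
    qed
    also have "\<dots> = 3 * card {T \<in> P \<inter> ?S. fst ` T \<subseteq> L} + (card (P - ?S) + 2 * card {T \<in> P - ?S. fst
        ` T = L})"
      by (simp only: sum.distrib sum_of_bool_card finite_Int finite_Diff fin simp_thms
          sum_constant of_nat_id mult_1_right
          flip: sum_distrib_left)
    finally show ?thesis .
  qed
  have mod3: "b mod 3 = 0" if "21 = a * 3 + b" for a b :: nat using that by presburger
  define d where "d = card {T \<in> P - ?S. fst ` T = {1, 2, 3}}"
  have "(\<Sum>p\<in>fano_points. snd p) = (\<Sum>i\<in>{1..<8::nat}. \<Sum>x\<in>{0..<3}. x)"
    by (simp only: fano_points_def sum.cartesian_product case_prod_unfold)
  also have "\<dots> = 21" by (simp add: numeral_3_eq_3)
  finally have "21 = (\<Sum>T\<in>P. \<Sum>p\<in>T. snd p)" by (simp only: tot)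
  also have "\<dots> = (\<Sum>T\<in>P \<inter> ?S. 3) + (\<Sum>T\<in>P - ?S. \<Sum>p\<in>T. snd p)"
    unfolding split
    by (intro arg_cong2[of _ _ _ _ "(+)"] sum.cong refl fano_block_weights(1)) (use PB in blast)+
  finally have "21 = card (P \<inter> ?S) * 3 + (\<Sum>T\<in>P - ?S. \<Sum>p\<in>T. snd p)"
    by (simp only: sum_constant of_nat_id)
  then have "(\<Sum>T\<in>P - ?S. \<Sum>p\<in>T. snd p) mod 3 = 0" by (rule mod3)
  moreover have "(\<Sum>T\<in>P - ?S. \<Sum>p\<in>T. snd p) mod 3 = (\<Sum>T\<in>P - ?S. (\<Sum>p\<in>T. snd p) mod 3) mod 3"
    by (rule mod_sum_eq[symmetric])
  moreover have "(\<Sum>T\<in>P - ?S. (\<Sum>p\<in>T. snd p) mod 3) = (\<Sum>T\<in>P - ?S. of_bool (fst ` T = {1, 2, 3}))"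
    by (intro sum.cong refl fano_block_weights(2)) (use PB in blast)+
  moreover have "\<dots> = d"
    unfolding d_def by (intro sum_of_bool_card finite_Diff fin)
  ultimately have d: "d mod 3 = 0" by metis
  have "{1, 2, 3} \<in> set fano_lines" by (simp add: fano_lines_def)
  from line[OF this, folded d_def] have "card (P - ?S) mod 3 = 0" using d by presburger
  moreover have "card (P - ?S) \<noteq> 6"
  proof
    assume 6: "card (P - ?S) = 6"
    then obtain T where T: "P \<inter> ?S = {T}" using size by (auto simp: card_1_singleton_iff)
    then have "T \<in> ?S" by blast
    then obtain i where i: "i \<in> {1..<8}" "T = {i} \<times> {0..<3}"
      unfolding fano_verticals_def by (rule imageE)
    then obtain L where L: "L \<in> set fano_lines" "i \<notin> L" using fano_line_avoiding i(1)
        unfolding set_upt by blast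
    have "{T' \<in> P \<inter> ?S. fst ` T' \<subseteq> L} = {}" unfolding T using i L by auto
    then have "9 = 6 + 2 * card {T \<in> P - ?S. fst ` T = L}"
      using line[OF L(1)] unfolding 6 by (simp only: card.empty mult_0_right add_0)
    then show False by (metis (no_types) even_add even_mult_iff even_numeral odd_numeral)
  qed
  ultimately show ?thesis using size by presburger
qed

lemma high_chromatic_index_21:
  "\<exists>(V::nat set) B. steiner_triple_system 21 V B \<and> real (chromatic_index B) \<ge> (real 21 + 3) / 2"
proof (rule high_chromatic_index_nat[OF fano_sts, of fano_verticals 4])
  have "card fano_verticals \<le> card {1..<8::nat}"
    unfolding fano_verticals_def by (rule card_image_le) simp
  then show "6 * card fano_verticals < 4 * (21 + 3)" by simp
qed (use fano_parallel_class_verticals in \<open>auto simp: fano_verticals_def\<close>)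

section \<open>Roots of unity\<close>

text \<open>A cyclic group of order \<open>n\<close> whose operation is the multiplication of a field, which makes
  equations between its elements accessible to field arithmetic.\<close>
definition unity_roots :: "nat \<Rightarrow> complex set" where
  "unity_roots n = {z. z ^ n = 1}"

lemma unity_roots_closed:
  "1 \<in> unity_roots n"
  "\<lbrakk>x \<in> unity_roots n; y \<in> unity_roots n\<rbrakk> \<Longrightarrow> x * y \<in> unity_roots n"
  "\<lbrakk>x \<in> unity_roots n; y \<in> unity_roots n\<rbrakk> \<Longrightarrow> x / y \<in> unity_roots n"
  "x \<in> unity_roots n \<Longrightarrow> inverse x \<in> unity_roots n"
  "x \<in> unity_roots n \<Longrightarrow> x ^ k \<in> unity_roots n"
  by (auto simp: unity_roots_def power_mult_distrib power_divide power_inverse)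
    (metis mult.commute power_mult power_one)

lemma unity_roots_nonzero: "\<lbrakk>x \<in> unity_roots n; n > 0\<rbrakk> \<Longrightarrow> x \<noteq> 0"
  by (auto simp: unity_roots_def power_0_left)

lemma unity_roots_finite: "n > 0 \<Longrightarrow> finite (unity_roots n)"
  and unity_roots_card: "n > 0 \<Longrightarrow> card (unity_roots n) = n"
  unfolding unity_roots_def using finite_roots_unity card_roots_unity_eq by auto

lemma power_gcd_eq_1:
  fixes x :: complex
  assumes "x ^ n = 1" "x ^ k = 1"
  shows "x ^ gcd k n = 1"
proof (cases "k = 0")
  case False
  then obtain a b where "k * a = n * b + gcd k n" using bezout_nat[of k n] by blast
  then have "x ^ (k * a) = x ^ (n * b + gcd k n)" by simp
  then have "(x ^ k) ^ a = (x ^ n) ^ b * x ^ gcd k n" by (simp only: power_add power_mult)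
  then show ?thesis using assms by simp
qed (use assms in simp)

lemma unity_roots_coprime_power:
  assumes "x \<in> unity_roots n" "x ^ k = 1" "coprime k n"
  shows "x = 1"
  using power_gcd_eq_1[of x n k] assms by (simp add: unity_roots_def)

lemma unity_roots_coprime_power_inj:
  assumes "x \<in> unity_roots n" "y \<in> unity_roots n" "n > 0" "x ^ k = y ^ k" "coprime k n"
  shows "x = y"
proof -
  have "(x / y) ^ k = 1" using assms unity_roots_nonzero by (simp add: power_divide)
  then have "x / y = 1" using unity_roots_coprime_power[of "x / y"] assms unity_roots_closed
      by blast
  then show ?thesis using assms unity_roots_nonzero by simp
qed

section \<open>The orders congruent to 15 modulo 18\<close>

definition next_level :: "nat \<Rightarrow> nat" where
  "next_level i = (if i = 2 then 0 else i + 1)"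

text \<open>Bose's construction: on one level, two elements are completed by their geometric mean on the
  next level, and three copies of one element form a vertical block.\<close>
definition bose_third :: "nat \<Rightarrow> nat \<times> complex \<Rightarrow> nat \<times> complex \<Rightarrow> nat \<times> complex" where
  "bose_third n p q =
     (let (i, x) = p; (j, y) = q
      in if i = j then (next_level i, (x * y) ^ ((n + 1) div 2))
         else if x = y then (3 - i - j, x)
         else if j = next_level i then (i, y\<^sup>2 / x) else (j, x\<^sup>2 / y))"

definition bose_points :: "nat \<Rightarrow> (nat \<times> complex) set" where
  "bose_points n = {0, 1, 2} \<times> unity_roots n"

definition bose_blocks :: "nat \<Rightarrow> (nat \<times> complex) set set" where
  "bose_blocks n = {{p, q, bose_third n p q} | p q. p \<in> bose_points n \<and> q \<in> bose_points n \<and> p \<noteq> q}"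

definition bose_verticals :: "nat \<Rightarrow> (nat \<times> complex) set set" where
  "bose_verticals n = (\<lambda>x. {0, 1, 2} \<times> {x}) ` unity_roots n"

text \<open>For odd \<open>n\<close>, raising to the power \<open>(n+1)/2\<close> is the square root in the group.\<close>
lemma unity_roots_half_power:
  assumes "x \<in> unity_roots n" "odd n"
  shows "(x ^ ((n + 1) div 2))\<^sup>2 = x" "(x\<^sup>2) ^ ((n + 1) div 2) = x"
proof -
  have "(n + 1) div 2 * 2 = n + 1" using assms(2) by presburger
  then show "(x ^ ((n + 1) div 2))\<^sup>2 = x" using assms(1)
    by (simp only: power_mult[symmetric]) (simp add: unity_roots_def)
  then show "(x\<^sup>2) ^ ((n + 1) div 2) = x" by (simp only: power_mult[symmetric] mult.commute)
qed

lemma bose_sts: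
  assumes n: "odd n"
  shows "steiner_triple_system (3 * n) (bose_points n) (bose_blocks n)"
  unfolding bose_blocks_def
proof (rule steiner_triple_system_third)
  let ?U = "unity_roots n"
  have n0: "n > 0" using n by (auto intro: odd_pos)
  show "finite (bose_points n)" "card (bose_points n) = 3 * n"
    using unity_roots_finite[OF n0] unity_roots_card[OF n0] by (auto simp: bose_points_def)
  note cl = unity_roots_closed[where n = n]
  note nz = unity_roots_nonzero[OF _ n0]
  define r where "r x = x ^ ((n + 1) div 2)" for x :: complex
  have r: "r x \<in> ?U" "(r x)\<^sup>2 = x" "r (x\<^sup>2) = x" if "x \<in> ?U" for x
    using unity_roots_half_power[OF that n] cl(5)[OF that] by (auto simp: r_def)
  have r_mid: "r (x * y) = r (y * x)" "r (x * y) \<noteq> x" "(r (x * y))\<^sup>2 / x = y" "r (x * y) \<in> ?U"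
    if "x \<in> ?U" "y \<in> ?U" "x \<noteq> y" for x y
  proof -
    have "(r (x * y))\<^sup>2 = x * y" using r(2) cl(2) that by blast
    then show "r (x * y) \<noteq> x" "(r (x * y))\<^sup>2 / x = y" using that nz by (auto simp: power2_eq_square)
    show "r (x * y) \<in> ?U" using r(1) cl(2) that by blast
  qed (simp add: mult.commute)
  have q_refl: "y\<^sup>2 / x \<in> ?U" "y\<^sup>2 / x \<noteq> x" "y\<^sup>2 / x \<noteq> y" "r (x * (y\<^sup>2 / x)) = y"
      "y\<^sup>2 / (y\<^sup>2 / x) = x"
    if "x \<in> ?U" "y \<in> ?U" "x \<noteq> y" for x y
  proof -
    have "x \<noteq> 0" "y \<noteq> 0" using that nz by auto
    then show "y\<^sup>2 / x \<noteq> y" "r (x * (y\<^sup>2 / x)) = y" "y\<^sup>2 / (y\<^sup>2 / x) = x"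
      using r(3)[OF that(2)] that(3) by (simp_all add: power2_eq_square divide_eq_eq)
    show "y\<^sup>2 / x \<in> ?U" by (intro cl that)
    show "y\<^sup>2 / x \<noteq> x"
    proof
      assume "y\<^sup>2 / x = x"
      then have "y\<^sup>2 = x\<^sup>2" using \<open>x \<noteq> 0\<close> by (simp add: power2_eq_square field_simps)
      then show False using r(3) that by metis
    qed
  qed
  show "bose_third n p q \<in> bose_points n \<and> bose_third n p q \<noteq> p \<and> bose_third n p q \<noteq> q \<and>
      bose_third n q p = bose_third n p q \<and> bose_third n p (bose_third n p q) = q"
    if pq: "p \<in> bose_points n" "q \<in> bose_points n" "p \<noteq> q" for p q
  proof -
    obtain i x j y where ij: "p = (i, x)" "q = (j, y)" by force
    then have U: "x \<in> ?U" "y \<in> ?U" and lev: "i \<in> {0, 1, 2}" "j \<in> {0, 1, 2}"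
      using pq by (auto simp: bose_points_def)
    have b: "bose_third n (k, a) (l, b) = (if k = l then (next_level k, r (a * b))
        else if a = b then (3 - k - l, a) else
            if l = next_level k then (k, b\<^sup>2 / a) else (l, a\<^sup>2 / b))"
      for k l a b by (simp add: bose_third_def r_def)
    show ?thesis
    proof (cases "x = y")
      case True
      then show ?thesis using lev U pq unfolding ij by (auto simp: bose_points_def b)
    next
      case False
      note yx = U(2,1) False[symmetric]
      note facts = r_mid(2-)[OF U False] q_refl[OF U False]
        r_mid(2-)[OF yx, unfolded mult.commute[of y x]] q_refl[OF yx]
      have nl: "next_level 0 = 1" "next_level (Suc 0) = 2" "next_level 2 = 0"
          by (auto simp: next_level_def)
      show ?thesis
        using lev unfolding ij
        by (elim insertE emptyE;
            simp add: b nl bose_points_def U False False[symmetric] facts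
                facts(1,5,6,9,13,14)[symmetric]
              r(3)[OF U(1)] r(3)[OF U(2)] nz[OF U(1)] nz[OF U(2)] mult.commute[of y x])
    qed
  qed
qed

text \<open>The weights 1, -2, 4 of the three levels satisfy \<open>2 w(i) + w(i+1) = 0\<close>, except for
  \<open>2 * 4 + 1 = 9\<close>. Modulo 9, only the vertical blocks, of weight 3, contribute to the total weight
  \<open>3 n\<close>. Thus their number in a parallel class is congruent to \<open>n\<close>, that is, to 2, modulo 3, and
  so it is at least 2.\<close>
lemma high_chromatic_index_bose:
  assumes n: "odd n" "n mod 3 = 2"
  shows "\<exists>(V::nat set) B. steiner_triple_system (3 * n) V B
      \<and> real (chromatic_index B) \<ge> (real (3 * n) + 3) / 2"
proof (rule high_chromatic_index_nat[OF bose_sts[OF n(1)], of "bose_verticals n" 2])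
  have n0: "n > 0" using n by (auto intro: odd_pos)
  note fin = unity_roots_finite[OF n0]
  show "3 * n mod 6 = 3" using n by presburger
  show finS: "finite (bose_verticals n)" using fin by (simp add: bose_verticals_def)
  have "card (bose_verticals n) \<le> n"
    using card_image_le[OF fin] unity_roots_card[OF n0] by (metis bose_verticals_def)
  then show "6 * card (bose_verticals n) < 2 * (3 * n + 3)" by simp
  fix P assume P: "parallel_class (bose_points n) (bose_blocks n) P"
  let ?S = "bose_verticals n"
  have PB: "P \<subseteq> bose_blocks n" using P by (auto simp: parallel_class_def partial_parallel_class_def)
  have finP: "finite P" using PB steiner_triple_system_finite[OF bose_sts[OF n(1)]]
      by (rule finite_subset)
  \<comment> \<open>Powers of -2, so that a block with two points on level 0 or 1 has weight 0.\<close>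
  define w :: "nat \<times> complex \<Rightarrow> int" where "w p = (if fst p = 0 then 1 else
      if fst p = 1 then -2 else 4)" for p
  have vertical: "(\<Sum>p\<in>T. w p) = 3" if "T \<in> ?S" for T
    using that by (auto simp: bose_verticals_def w_def)
  have other: "(\<Sum>p\<in>T. w p) mod 9 = 0" if "T \<in> P - ?S" for T
  proof -
    have "T \<in> bose_blocks n" using that PB by blast
    then obtain p q where pq: "T = {p, q, bose_third n p q}" "p \<in> bose_points n"
        "q \<in> bose_points n" "p \<noteq> q"
      unfolding bose_blocks_def by blast
    obtain i x j y where ij: "p = (i, x)" "q = (j, y)" by force
    have lev: "i \<in> {0, 1, 2}" "j \<in> {0, 1, 2}" using pq by (auto simp: bose_points_def ij)
    have "x \<noteq> y" if "i \<noteq> j"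
    proof
      assume "x = y"
      then have "T = {0, 1, 2} \<times> {x}" using lev \<open>i \<noteq> j\<close> pq(1) by (auto simp: ij bose_third_def)
      moreover have "x \<in> unity_roots n" using pq by (auto simp: bose_points_def ij)
      ultimately show False using \<open>T \<in> P - ?S\<close> by (auto simp: bose_verticals_def)
    qed
    have "card T = 3" using PB that sts_blockD(2)[OF bose_sts[OF n(1)]] by blast
    then have "bose_third n p q \<notin> {p, q}"
      using pq(1,4) by (cases "bose_third n p q \<in> {p, q}") (auto simp: insert_absorb)
    then have "(\<Sum>p\<in>T. w p) = w p + w q + w (bose_third n p q)"
      unfolding pq(1) using pq(4) by auto
    also have "\<dots> mod 9 = 0"
      using lev \<open>i \<noteq> j \<Longrightarrow> x \<noteq> y\<close>
      by (elim insertE emptyE; simp add: ij bose_third_def w_def next_level_def)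
    finally show ?thesis .
  qed
  have "(\<Sum>p\<in>bose_points n. w p) = (\<Sum>i\<in>{0, 1, 2}. \<Sum>x\<in>unity_roots n. w (i, x))"
    by (simp only: bose_points_def sum.cartesian_product case_prod_unfold prod.collapse)
  also have "\<dots> = 3 * int n" using unity_roots_card[OF n0] by (simp add: w_def)
  finally have "3 * int n = (\<Sum>T\<in>P. \<Sum>p\<in>T. w p)"
    by (simp only: sum_parallel_class[OF bose_sts[OF n(1)] P])
  also have "\<dots> = (\<Sum>T\<in>P \<inter> ?S. \<Sum>p\<in>T. w p) + (\<Sum>T\<in>P - ?S. \<Sum>p\<in>T. w p)"
    using finP by (rule sum.Int_Diff)
  also have "(\<Sum>T\<in>P \<inter> ?S. \<Sum>p\<in>T. w p) = 3 * int (card (P \<inter> ?S))"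
    using vertical by simp
  finally have eq: "3 * int n = 3 * int (card (P \<inter> ?S)) + (\<Sum>T\<in>P - ?S. \<Sum>p\<in>T. w p)" .
  have "9 dvd (\<Sum>T\<in>P - ?S. \<Sum>p\<in>T. w p)" by (rule dvd_sum) (use other in presburger)
  then obtain k where "(\<Sum>T\<in>P - ?S. \<Sum>p\<in>T. w p) = 9 * k" by (elim dvdE)
  then show "2 \<le> card (P \<inter> ?S)" using eq n(2) by presburger
qed

section \<open>Colouring the cycles of a permutation\<close>

lemma least_period:
  assumes "finite X" "inj_on g X" "g ` X \<subseteq> X" "x \<in> X"
  obtains h where "h > 0" "(g ^^ h) x = x" "inj_on (\<lambda>i. (g ^^ i) x) {..<h}"
proof -
  have in_X: "(g ^^ i) x \<in> X" for i using assms(3,4) by (induction i) auto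
  have cancel: "(g ^^ i) x = (g ^^ j) x" if "(g ^^ (k + i)) x = (g ^^ (k + j)) x" for i j k
    using that by (induction k) (use in_X assms(2) in \<open>auto simp: inj_on_def\<close>)
  have collapse: "(g ^^ (j - i)) x = x" if "i < j" "(g ^^ i) x = (g ^^ j) x" for i j
    using cancel[of i 0 "j - i"] that by simp
  have "\<not> inj (\<lambda>i. (g ^^ i) x)"
    using finite_subset[of "range (\<lambda>i. (g ^^ i) x)" X] in_X assms(1) finite_imageD
    by (metis image_subsetI infinite_UNIV_nat)
  then obtain i j where "i < j" "(g ^^ i) x = (g ^^ j) x"
    unfolding inj_on_def by (metis UNIV_I linorder_neqE_nat)
  then have ex: "\<exists>h. h > 0 \<and> (g ^^ h) x = x" using collapse by (intro exI[of _ "j - i"]) auto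
  define h where "h = (LEAST h. h > 0 \<and> (g ^^ h) x = x)"
  have h: "h > 0" "(g ^^ h) x = x" using LeastI_ex[OF ex] by (auto simp: h_def)
  have "(g ^^ i) x \<noteq> (g ^^ j) x" if "i < j" "j < h" for i j
    using collapse[OF that(1)] not_less_Least[of "j - i" "\<lambda>h. h > 0 \<and> (g ^^ h) x = x"] that
    by (auto simp: h_def)
  then have "inj_on (\<lambda>i. (g ^^ i) x) {..<h}"
    by (intro inj_onI) (metis lessThan_iff linorder_neqE_nat)
  then show thesis using that h by blast
qed

text \<open>Along a cycle of even length two colours alternate. A cycle of odd length \<open>h\<close> needs one
  element of \<open>B\<close>, the break, where the colour stays the same. The number of breaks is the number
  of odd cycles, which is bounded through a weight \<open>c\<close>: a cycle of length \<open>h\<close> has total weight at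
  least 1 if each of its elements has weight at least \<open>1/h\<close>. The proof removes one cycle at a
  time.\<close>
lemma alternating_colouring_with_breaks:
  fixes c :: "'a \<Rightarrow> real"
  assumes "finite X" "inj_on g X" "g ` X \<subseteq> X"
    and "\<And>x. x \<in> X \<Longrightarrow> g x \<noteq> x"
    and "\<And>x. x \<in> X \<Longrightarrow> c x \<ge> 0"
    and "\<And>x h. \<lbrakk>x \<in> X; odd h; (g ^^ h) x = x\<rbrakk> \<Longrightarrow> 1 / real h \<le> c x"
  shows "\<exists>B col. B \<subseteq> X \<and> real (card B) \<le> (\<Sum>x\<in>X. c x) \<and> (\<forall>b\<in>B. g b \<notin> B) \<and>
    (\<forall>x\<in>X. if x \<in> B then col x \<and> col (g x) else col (g x) \<longleftrightarrow> \<not> col x)"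
  using assms
proof (induction X rule: finite_psubset_induct)
  case (psubset X)
  show ?case
  proof (cases "X = {}")
    case True
    then show ?thesis by auto
  next
    case False
    then obtain x where x: "x \<in> X" by blast
    obtain h where h: "h > 0" "(g ^^ h) x = x" "inj_on (\<lambda>i. (g ^^ i) x) {..<h}"
      using least_period[OF psubset.hyps psubset.prems(1,2) x] by blast
    define orb where "orb = (\<lambda>i. (g ^^ i) x) ` {..<h}"
    have in_X: "(g ^^ i) x \<in> X" for i using x psubset.prems(2) by (induction i) auto
    have OX: "orb \<subseteq> X" using in_X by (auto simp: orb_def)
    have fin_orb: "finite orb" "card orb = h" using h(3) by (auto simp: orb_def card_image)
    have x_orb: "x \<in> orb" using h(1) by (auto simp: orb_def intro: image_eqI[of _ _ 0])
    have g_step: "g ((g ^^ i) x) = (g ^^ (if i + 1 = h then 0 else i + 1)) x" if "i < h" for i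
      using h(2) by (cases "i + 1 = h") auto
    have closed: "y \<in> orb" if y: "y \<in> X" "g y \<in> orb" for y
    proof -
      obtain i where i: "i < h" "g y = (g ^^ i) x" using y(2) by (auto simp: orb_def)
      obtain j where j: "j < h" "g y = g ((g ^^ j) x)"
      proof (cases i)
        case 0
        then show ?thesis using that[of "h - 1"] g_step[of "h - 1"] i h(1) by auto
      next
        case (Suc k)
        then show ?thesis using that[of k] i by auto
      qed
      then have "y = (g ^^ j) x" using inj_onD[OF psubset.prems(1) j(2) y(1) in_X] by simp
      then show ?thesis using j(1) by (auto simp: orb_def)
    qed
    define Y where "Y = X - orb"
    have Y: "Y \<subset> X" "Y \<subseteq> X" using x_orb x by (auto simp: Y_def)
    have gY: "g ` Y \<subseteq> Y" using closed psubset.prems(2) by (auto simp: Y_def)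
    have "\<exists>B col. B \<subseteq> Y \<and> real (card B) \<le> (\<Sum>x\<in>Y. c x) \<and> (\<forall>b\<in>B. g b \<notin> B) \<and>
        (\<forall>x\<in>Y. if x \<in> B then col x \<and> col (g x) else col (g x) \<longleftrightarrow> \<not> col x)"
      using Y(2) psubset.prems
      by (intro psubset.IH[OF Y(1) inj_on_subset[OF psubset.prems(1) Y(2)] gY]) blast+
    then obtain B' col' where IH: "B' \<subseteq> Y" "real (card B') \<le> (\<Sum>x\<in>Y. c x)" "\<forall>b\<in>B'. g b \<notin> B'"
      "\<forall>x\<in>Y. if x \<in> B' then col' x \<and> col' (g x) else col' (g x) \<longleftrightarrow> \<not> col' x"
      by (elim exE conjE)
    \<comment> \<open>The colour at distance i from x along its cycle. If h is odd, the first two positions share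
      a colour.\<close>
    define \<kappa> where "\<kappa> i \<longleftrightarrow> odd i \<or> (odd h \<and> i = 0)" for i :: nat
    define B where "B = B' \<union> (if odd h then {x} else {})"
    define col where "col y = (if y \<in> orb then y \<in> (\<lambda>i. (g ^^ i) x) ` {i. i < h
        \<and> \<kappa> i} else col' y)" for y
    have col_orb: "col ((g ^^ i) x) \<longleftrightarrow> \<kappa> i" if "i < h" for i
    proof -
      have "(g ^^ i) x \<in> (\<lambda>i. (g ^^ i) x) ` {i. i < h \<and> \<kappa> i} \<longleftrightarrow> i \<in> {i. i < h \<and> \<kappa> i}"
        by (rule inj_on_image_mem_iff[OF h(3)]) (use that in auto)
      then show ?thesis using that by (auto simp: col_def orb_def)
    qed
    have h1: "h \<noteq> 1" using h(2) psubset.prems(3)[OF x] by auto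
    have "B \<subseteq> X" using IH(1) Y x by (auto simp: B_def)
    moreover have "real (card B) \<le> (\<Sum>x\<in>X. c x)"
    proof -
      have "real (card B) \<le> real (card B') + of_bool (odd h)"
        using card_Un_le[of B' "{x}"] by (auto simp: B_def)
      also have "\<dots> \<le> (\<Sum>x\<in>Y. c x) + (\<Sum>x\<in>orb. c x)"
      proof (rule add_mono[OF IH(2)])
        show "of_bool (odd h) \<le> (\<Sum>x\<in>orb. c x)"
        proof (cases "odd h")
          case True
          have "(\<Sum>y\<in>orb. 1 / real h) \<le> (\<Sum>y\<in>orb. c y)"
          proof (rule sum_mono)
            fix y assume "y \<in> orb"
            then obtain i where i: "y = (g ^^ i) x" by (auto simp: orb_def)
            have "(g ^^ h) y = (g ^^ i) ((g ^^ h) x)"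
              unfolding i by (simp only: funpow_add[symmetric, THEN fun_cong, unfolded o_apply]
                  add.commute)
            then show "1 / real h \<le> c y"
              using psubset.prems(5)[of y h] True h(2) in_X i by simp
          qed
          then show ?thesis using fin_orb h(1) True by simp
        next
          case False
          then show ?thesis using psubset.prems(4) OX by (auto intro!: sum_nonneg)
        qed
      qed
      also have "\<dots> = (\<Sum>x\<in>X. c x)"
        unfolding Y_def using psubset.hyps OX by (rule sum.subset_diff[symmetric, rotated])
      finally show ?thesis .
    qed
    moreover have "\<forall>b\<in>B. g b \<notin> B"
    proof
      fix b assume b: "b \<in> B"
      show "g b \<notin> B"
      proof (cases "b \<in> B'")
        case True
        then have "g b \<in> Y" "g b \<notin> B'" using IH(1,3) gY by blast+
        then show ?thesis using x_orb by (auto simp: B_def Y_def)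
      next
        case False
        then have b: "b = x" "odd h" using b by (auto simp: B_def split: if_splits)
        have "(g ^^ 1) x \<in> orb" using h(1) h1 unfolding orb_def by (intro imageI) simp
        then have "g x \<in> orb" by simp
        then show ?thesis using b psubset.prems(3)[OF x] IH(1) by (auto simp: B_def Y_def)
      qed
    qed
    moreover have "\<forall>y\<in>X. if y \<in> B then col y \<and> col (g y) else col (g y) \<longleftrightarrow> \<not> col y"
    proof
      fix y assume y: "y \<in> X"
      show "if y \<in> B then col y \<and> col (g y) else col (g y) \<longleftrightarrow> \<not> col y"
      proof (cases "y \<in> orb")
        case True
        then obtain i where i: "i < h" "y = (g ^^ i) x" by (auto simp: orb_def)
        have "y = x \<longleftrightarrow> i = 0"
          using inj_onD[OF h(3), of i 0] i h(1) by auto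
        then have yB: "y \<in> B \<longleftrightarrow> odd h \<and> i = 0" using True IH(1) by (auto simp: B_def Y_def)
        have "col y \<longleftrightarrow> \<kappa> i" using col_orb i by simp
        moreover have "col (g y) \<longleftrightarrow> \<kappa> (if i + 1 = h then 0 else i + 1)"
          unfolding i(2) g_step[OF i(1)] by (rule col_orb) (use i(1) h(1) in auto)
        ultimately show ?thesis using yB i(1) h1 by (auto simp: \<kappa>_def)
      next
        case False
        then have "y \<in> Y" "g y \<notin> orb" using y gY by (auto simp: Y_def)
        then show ?thesis using IH(4) False x_orb by (auto simp: B_def col_def)
      qed
    qed
    ultimately show ?thesis by blast
  qed
qed

section \<open>Short orbits of squaring\<close>

text \<open>The orbits of the squaring map on pairs of inverse elements are the cycles to be coloured;
  colouring pairs instead of elements gives inverse elements the same colour.\<close>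
definition inverse_pairs :: "nat \<Rightarrow> complex set set" where
  "inverse_pairs n = (\<lambda>x. {x, inverse x}) ` (unity_roots n - {1})"

lemma inverse_neq:
  assumes "x \<in> unity_roots n - {1}" "odd n"
  shows "inverse x \<noteq> x"
proof
  assume "inverse x = x"
  moreover have "x \<noteq> 0" using assms unity_roots_nonzero odd_pos by blast
  ultimately have "x ^ 2 = 1" by (metis power2_eq_square right_inverse)
  then show False using unity_roots_coprime_power[of x n 2] assms by auto
qed

lemma card_Union_inverse_pairs:
  assumes n: "odd n" and Y: "Y \<subseteq> inverse_pairs n"
  shows "card (\<Union>Y) = 2 * card Y"
proof -
  have fin: "finite Y" using Y unity_roots_finite[OF odd_pos[OF n]]
    by (metis inverse_pairs_def finite_Diff finite_imageI finite_subset)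
  have "card (\<Union>Y) = (\<Sum>S\<in>Y. card S)"
  proof (rule card_Union_disjoint)
    show "disjoint Y"
      unfolding disjoint_def
    proof (intro ballI impI)
      fix S T assume "S \<in> Y" "T \<in> Y" "S \<noteq> T"
      then have "S \<in> inverse_pairs n" "T \<in> inverse_pairs n" using Y by blast+
      then obtain x y where "S = {x, inverse x}" "T = {y, inverse y}"
        unfolding inverse_pairs_def by (elim imageE)
      then show "S \<inter> T = {}" using \<open>S \<noteq> T\<close> by auto
    qed
    show "finite S" if "S \<in> Y" for S using that Y by (auto simp: inverse_pairs_def)
  qed
  also have "\<dots> = (\<Sum>S\<in>Y. 2)"
    using Y inverse_neq[OF _ n] by (intro sum.cong) (fastforce simp: inverse_pairs_def)+
  finally show ?thesis by simp
qed

lemma card_inverse_pairs: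
  assumes "odd n"
  shows "2 * card (inverse_pairs n) = n - 1"
proof -
  have "\<Union>(inverse_pairs n) = unity_roots n - {1}"
    using unity_roots_closed(4)[of _ n] by (auto simp: inverse_pairs_def)
  then have "card (\<Union>(inverse_pairs n)) = n - 1"
    using unity_roots_card odd_pos[OF assms] unity_roots_closed(1) unity_roots_finite by simp
  then show ?thesis using card_Union_inverse_pairs[OF assms order_refl] by simp
qed

text \<open>By the identity of Bezout, the common roots are those of exponent \<open>gcd k n\<close>.\<close>
lemma card_common_roots:
  assumes "n > 0"
  shows "card {x \<in> unity_roots n. x ^ k = 1} = gcd k n"
proof -
  have "x ^ m = 1" if "x ^ gcd k n = 1" "gcd k n dvd m" for x :: complex and m
    using that by (auto elim!: dvdE simp: power_mult)
  then have "{x \<in> unity_roots n. x ^ k = 1} = unity_roots (gcd k n)"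
    unfolding unity_roots_def using power_gcd_eq_1 gcd_dvd1[of k n] gcd_dvd2[of k n] by blast
  then show ?thesis using unity_roots_card assms by simp
qed

text \<open>A pair fixed by the \<open>h\<close>-fold squaring satisfies \<open>x^(2^h) = x\<close> or \<open>x^(2^h) = x^-1\<close>. The
  summand 2 on the left accounts for the element 1, which both gcds count.\<close>
lemma card_fixed_inverse_pairs:
  assumes n: "odd n"
  shows "2 * card {S \<in> inverse_pairs n. (\<lambda>x. x ^ (2 ^ h)) ` S = S} + 2 \<le> gcd (2 ^ h - 1) n + gcd
      (2 ^ h + 1) n"
proof -
  let ?F = "{S \<in> inverse_pairs n. (\<lambda>x. x ^ (2 ^ h)) ` S = S}"
  let ?R = "\<lambda>k. {x \<in> unity_roots n. x ^ k = 1}"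
  have n0: "n > 0" using n by (rule odd_pos)
  have finR: "finite (?R k)" for k using unity_roots_finite[OF n0] by simp
  have oneR: "1 \<in> ?R k" for k using unity_roots_closed(1) by simp
  have sub: "\<Union>?F \<subseteq> (?R (2 ^ h - 1) - {1}) \<union> (?R (2 ^ h + 1) - {1})"
  proof
    fix x assume "x \<in> \<Union>?F"
    then obtain S where S: "S \<in> inverse_pairs n" "(\<lambda>x. x ^ (2 ^ h)) ` S = S" "x \<in> S" by blast
    then obtain y where y: "S = {y, inverse y}" "y \<in> unity_roots n" "y \<noteq> 1"
        by (auto simp: inverse_pairs_def)
    then have x: "S = {x, inverse x}" "x \<in> unity_roots n" "x \<noteq> 1"
      using S(3) unity_roots_closed(4) by auto
    have x0: "x \<noteq> 0" using unity_roots_nonzero[OF x(2) n0] .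
    have "x ^ (2 ^ h) \<in> {x, inverse x}" using S(2,3) x(1) by blast
    then have "x ^ (2 ^ h - 1) = 1 \<or> x ^ (2 ^ h + 1) = 1"
    proof (elim insertE emptyE)
      assume "x ^ (2 ^ h) = x"
      then have "x * x ^ (2 ^ h - 1) = x * 1" by (simp flip: power_Suc)
      then show ?thesis using x0 by simp
    next
      assume "x ^ (2 ^ h) = inverse x"
      then show ?thesis using x0 by simp
    qed
    then show "x \<in> (?R (2 ^ h - 1) - {1}) \<union> (?R (2 ^ h + 1) - {1})" using x by blast
  qed
  have "card (\<Union>?F) \<le> card (?R (2 ^ h - 1) - {1}) + card (?R (2 ^ h + 1) - {1})"
    using card_mono[OF _ sub] card_Un_le finR by (meson finite_Diff finite_UnI order_trans)
  also have "\<dots> = (gcd (2 ^ h - 1) n - 1) + (gcd (2 ^ h + 1) n - 1)"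
    using card_common_roots[OF n0] oneR finR by (simp only: card_Diff_singleton)
  finally have le: "2 * card ?F \<le> (gcd (2 ^ h - 1) n - 1) + (gcd (2 ^ h + 1) n - 1)"
    using card_Union_inverse_pairs[OF n, of ?F] by simp
  have shift: "a + 2 \<le> b + c" if "a \<le> (b - 1) + (c - 1)" "b > 0" "c > 0" for a b c :: nat
    using that by linarith
  have "gcd k n > 0" for k using n0 by simp
  then show ?thesis by (intro shift[OF le])
qed

lemma gcd_prime_nat: 
  assumes "prime (p::nat)" shows "gcd p n = (if p dvd n then p else 1)"
  using assms prime_imp_coprime[OF assms, of n] by (auto simp: gcd_nat.absorb1)

lemma gcd_prime_product_nat:
  fixes p q n :: nat
  assumes p: "prime p" and q: "prime q" and "p \<noteq> q"
  shows "gcd (p * q) n = (if p dvd n then p else 1) * (if q dvd n then q else 1)"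
proof (cases "p dvd n")
  case False
  then have "gcd (p * q) n = gcd q n"
    using prime_imp_coprime[OF p] by (intro gcd_mult_left_left_cancel) (simp add: coprime_commute)
  then show ?thesis using False gcd_prime_nat[OF q] by simp
next
  case p_dvd: True
  show ?thesis
  proof (cases "q dvd n")
    case False
    then have "gcd (p * q) n = gcd p n"
      using prime_imp_coprime[OF q] by (intro gcd_mult_left_right_cancel) (simp add:
          coprime_commute)
    then show ?thesis using False gcd_prime_nat[OF p] by simp
  next
    case True
    then have "p * q dvd n" using p_dvd assms by (intro divides_mult primes_coprime)
    then show ?thesis using p_dvd True by (simp add: gcd_nat.absorb1)
  qed
qed

lemma prime_683: "prime (683::nat)"
  by simp

text \<open>The numbers in question are \<open>2^h - 1\<close> and \<open>2^h + 1\<close> for \<open>h = 3, 5, 7, 9, 11\<close>. Their prime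
  factors besides 3 are 7, 31, 11, 127, 43, 73, 19, 23, 89 and 683.\<close>
lemma special_gcds:
  assumes "coprime 3 (n::nat)"
  shows "gcd 7 n = (if 7 dvd n then 7 else 1)" "gcd 9 n = 1"
    "gcd 31 n = (if 31 dvd n then 31 else 1)" "gcd 33 n = (if 11 dvd n then 11 else 1)"
    "gcd 127 n = (if 127 dvd n then 127 else 1)" "gcd 129 n = (if 43 dvd n then 43 else 1)"
    "gcd 511 n = (if 7 dvd n then 7 else 1) * (if 73 dvd n then 73 else 1)"
    "gcd 513 n = (if 19 dvd n then 19 else 1)"
    "gcd 2047 n = (if 23 dvd n then 23 else 1) * (if 89 dvd n then 89 else 1)"
    "gcd 2049 n = (if 683 dvd n then 683 else 1)"
proof -
  have pr: "prime (7::nat)" "prime (31::nat)" "prime (11::nat)" "prime (127::nat)" "prime (43::nat)"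
    "prime (73::nat)" "prime (19::nat)" "prime (23::nat)" "prime (89::nat)" "prime (683::nat)"
    by (rule prime_683 | simp)+
  have three: "gcd (3 * m) n = gcd m n" for m
    using assms by (intro gcd_mult_left_left_cancel) (simp add: coprime_commute)
  note pr' = pr[THEN gcd_prime_nat]
  show "gcd 7 n = (if 7 dvd n then 7 else 1)" "gcd 31 n = (if 31 dvd n then 31 else 1)"
    "gcd 127 n = (if 127 dvd n then 127 else 1)" by (simp_all only: pr')
  have "gcd (3 * (3 * 1)) n = 1" "gcd (3 * 11) n = gcd 11 n" "gcd (3 * 43) n = gcd 43 n"
    "gcd (3 * 683) n = gcd 683 n" "gcd (3 * (3 * (3 * 19))) n = gcd 19 n"
    by (simp_all only: three) simp
  then show "gcd 9 n = 1" "gcd 33 n = (if 11 dvd n then 11 else 1)"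
    "gcd 129 n = (if 43 dvd n then 43 else 1)" "gcd 2049 n = (if 683 dvd n then 683 else 1)"
    "gcd 513 n = (if 19 dvd n then 19 else 1)"
    by (simp_all add: pr')
  show "gcd 511 n = (if 7 dvd n then 7 else 1) * (if 73 dvd n then 73 else 1)"
    "gcd 2047 n = (if 23 dvd n then 23 else 1) * (if 89 dvd n then 89 else 1)"
    using gcd_prime_product_nat[OF pr(1,6), of n] gcd_prime_product_nat[OF pr(8,9), of n]
        by simp_all
qed

text \<open>The cofactor of \<open>q\<close> in \<open>n\<close> is itself congruent to 1 or to 5 modulo 6, which leaves large
  gaps between the multiples to be considered.\<close>
lemma multiple_1_mod_6:
  fixes n q :: nat
  assumes n: "n mod 6 = 1" and q: "q dvd n"
  shows "q mod 6 = 1 \<Longrightarrow> n = q \<or> n = 7 * q \<or> n \<ge> 13 * q" and "q mod 6 = 5 \<Longrightarrow> n \<ge> 5 * q"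
proof -
  obtain j where j: "n = q * j" using q by (elim dvdE)
  have m: "(q mod 6) * (j mod 6) mod 6 = 1" using n by (simp add: j mod_mult_eq)
  have j6: "j mod 6 \<in> {0, 1, 2, 3, 4, 5}" by (simp) presburger
  show "n = q \<or> n = 7 * q \<or> n \<ge> 13 * q" if "q mod 6 = 1"
  proof -
    have "j mod 6 = 1" using m that by simp
    then have "j = 1 \<or> j = 7 \<or> j \<ge> 13" by presburger
    then show ?thesis by (auto simp: j mult.commute)
  qed
  show "n \<ge> 5 * q" if "q mod 6 = 5"
  proof -
    have "j mod 6 = 5" using m that j6 by auto
    then have "j \<ge> 5" by presburger
    then show ?thesis by (simp add: j mult.commute)
  qed
qed

text \<open>Every prime from \<open>special_gcds\<close> that divides \<open>n\<close> adds a fixed amount to the left side, as do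
  the products \<open>7 * 73\<close> and \<open>23 * 89\<close>; but by \<open>multiple_1_mod_6\<close> such a divisor forces \<open>n\<close> to be
  large. The orders 49 and 217 are the ones where this trade-off is too close: 217 still satisfies
  the inequality, 49 does not.\<close>
lemma short_orbit_excess:
  fixes n :: nat
  assumes n: "n mod 6 = 1" "n \<notin> {1, 7, 19, 31, 43, 49, 73, 127, 511}"
  shows "11550 * (gcd 7 n + gcd 9 n - 2) + 5544 * (gcd 31 n + gcd 33 n - 2)
      + 2970 * (gcd 127 n + gcd 129 n - 2) + 1540 * (gcd 511 n + gcd 513 n - 2)
      + 630 * (gcd 2047 n + gcd 2049 n - 2) < 1540 * (n - 1)"
proof (cases "n = 217")
  case True
  show ?thesis unfolding True by (simp add: gcd_non_0_nat)
next
  case False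
  have cop: "coprime 3 n"
  proof -
    have "\<not> 3 dvd n" using n(1) by presburger
    then show ?thesis by (intro prime_imp_coprime) simp_all
  qed
  \<comment> \<open>The constants below are the amounts, in units of 1540, that a divisor adds: for 7 it is 51,
    since 6 * 11550 + 6 * 1540 = 51 * 1540. The divisors 511 and 2047 carry the excess of 73 * 7 -
    1 and 89 * 23 - 1 over the sums 72 + 6 and 88 + 22.\<close>
  define x where "x q c = (if q dvd n then c else 0)" for q c :: nat
  have le: "x q c \<le> c" for q c by (simp add: x_def)
  have "11550 * (gcd 7 n + gcd 9 n - 2) + 5544 * (gcd 31 n + gcd 33 n - 2)
      + 2970 * (gcd 127 n + gcd 129 n - 2) + 1540 * (gcd 511 n + gcd 513 n - 2)
      + 630 * (gcd 2047 n + gcd 2049 n - 2) = 1540 * (x 7 51 + x 11 36 + x 31 108 + x 127 243 + x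
          43 81
      + x 73 72 + x 511 432 + x 19 18 + x 23 9 + x 89 36 + x 2047 792 + x 683 279)"
  proof -
    have cop_primes: "coprime 7 (73::nat)" "coprime 23 (89::nat)" by (rule primes_coprime; simp)+
    have "7 * 73 dvd n \<longleftrightarrow> 7 dvd n \<and> 73 dvd n"
      using divides_mult[OF _ _ cop_primes(1), of n] dvd_mult_left[of 7 73 n] dvd_mult_right[of 7
          73 n] by blast
    moreover have "23 * 89 dvd n \<longleftrightarrow> 23 dvd n \<and> 89 dvd n"
      using divides_mult[OF _ _ cop_primes(2), of n] dvd_mult_left[of 23 89 n] dvd_mult_right[of
          23 89 n] by blast
    ultimately show ?thesis unfolding special_gcds[OF cop] x_def
      by simp
  qed
  also have "\<dots> < 1540 * (n - 1)"
  proof (rule mult_strict_left_mono)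
    note mult = multiple_1_mod_6[OF n(1)]
    have zero: "x q c = 0" if "n < t" "q dvd n \<Longrightarrow> n \<ge> t" for q c t
      using that by (auto simp: x_def)
    \<comment> \<open>The thresholds are the least multiples of the divisors that are congruent to 1 modulo 6 and
      not excluded.\<close>
    have z0: "n < 91 \<Longrightarrow> x 7 51 = 0" using mult(1)[of 7] n(2) by (intro zero[of 91]) auto
    have z1: "n < 55 \<Longrightarrow> x 11 36 = 0" using mult(2)[of 11] by (intro zero[of 55]) auto
    have z2: "n < 403 \<Longrightarrow> x 31 108 = 0" using mult(1)[of 31] n(2) False by (intro zero[of 403]) auto
    have z3: "n < 889 \<Longrightarrow> x 127 243 = 0" using mult(1)[of 127] n(2) by (intro zero[of 889]) auto
    have z4: "n < 301 \<Longrightarrow> x 43 81 = 0" using mult(1)[of 43] n(2) by (intro zero[of 301]) auto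
    have z5: "n < 949 \<Longrightarrow> x 73 72 = 0" using mult(1)[of 73] n(2) by (intro zero[of 949]) auto
    have z6: "n < 3577 \<Longrightarrow> x 511 432 = 0" using mult(1)[of 511] n(2) by (intro zero[of 3577]) auto
    have z7: "n < 133 \<Longrightarrow> x 19 18 = 0" using mult(1)[of 19] n(2) by (intro zero[of 133]) auto
    have z8: "n < 115 \<Longrightarrow> x 23 9 = 0" using mult(2)[of 23] by (intro zero[of 115]) auto
    have z9: "n < 445 \<Longrightarrow> x 89 36 = 0" using mult(2)[of 89] by (intro zero[of 445]) auto
    have z10: "n < 2047 \<Longrightarrow> x 2047 792 = 0" using mult(1)[of 2047] by (intro zero[of 2047]) auto
    have z11: "n < 3415 \<Longrightarrow> x 683 279 = 0" using mult(2)[of 683] by (intro zero[of 3415]) auto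
    note zeros = z0 z1 z2 z3 z4 z5 z6 z7 z8 z9 z10 z11
    note bounds = le[of 7 51] le[of 11 36] le[of 31 108] le[of 127 243] le[of 43 81] le[of 73 72]
      le[of 511 432] le[of 19 18] le[of 23 9] le[of 89 36] le[of 2047 792] le[of 683 279]
    have "n > 1" using n by (cases n) auto
    have "n < 55 \<or> 55 \<le> n \<and> n < 91 \<or> 91 \<le> n \<and> n < 115 \<or> 115 \<le> n \<and> n < 133
      \<or> 133 \<le> n \<and> n < 301 \<or> 301 \<le> n \<and> n < 403 \<or> 403 \<le> n \<and> n < 889 \<or> 889 \<le> n \<and> n < 2047
      \<or> 2047 \<le> n \<and> n < 3415 \<or> 3415 \<le> n"
      by linarith
    then show "x 7 51 + x 11 36 + x 31 108 + x 127 243 + x 43 81 + x 73 72 + x 511 432 + x 19 18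
        + x 23 9 + x 89 36 + x 2047 792 + x 683 279 < n - 1"
      by (elim disjE conjE; insert zeros bounds \<open>n > 1\<close>; simp; linarith?)
  qed simp
  finally show ?thesis .
qed

text \<open>Here \<open>p\<close> stands for the number of odd orbits; \<open>few_breaks\<close> derives the hypothesis, and
  explains its coefficients. For \<open>n = 49\<close> the inequality between real numbers would be too weak,
  and one needs that \<open>p\<close> is an integer.\<close>
lemma break_count:
  fixes n p :: nat
  assumes n: "n mod 6 = 1" "n \<notin> {1, 7, 19, 31, 43, 73, 127, 511}"
    and p: "90090 * p \<le> 3465 * (n - 1) + (11550 * (gcd 7 n + gcd 9 n - 2) + 5544 * (gcd 31 n + gcd
        33 n - 2)
      + 2970 * (gcd 127 n + gcd 129 n - 2) + 1540 * (gcd 511 n + gcd 513 n - 2)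
      + 630 * (gcd 2047 n + gcd 2049 n - 2))" (is "_ \<le> _ + ?E n")
  shows "18 * p < n - 1"
proof (cases "n = 49")
  case True
  have "?E 49 = 78540" by (simp add: gcd_non_0_nat)
  with p have "90090 * p \<le> 3465 * (49 - 1) + 78540" unfolding True by (simp only:)
  then have "p \<le> 2" by simp
  then show ?thesis unfolding True by simp
next
  case False
  then have "?E n < 1540 * (n - 1)" using n by (intro short_orbit_excess) simp_all
  with p have "90090 * p < 5005 * (n - 1)" by linarith
  then show ?thesis by linarith
qed

section \<open>Two points at infinity\<close>

lemma prod_parallel_class:
  assumes "steiner_triple_system v V B" "parallel_class V B P"
  shows "(\<Prod>T\<in>P. \<Prod>x\<in>T. w x) = (\<Prod>x\<in>V. w x :: 'b :: comm_monoid_mult)"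
proof -
  have "P \<subseteq> B" "disjoint P"
    using assms(2) by (auto simp: parallel_class_def partial_parallel_class_def)
  then have "prod w (\<Union>P) = (\<Prod>T\<in>P. prod w T)"
    using sts_blockD(3)[OF assms(1)]
    by (subst prod.Union_disjoint) (auto dest: disjointD)
  then show ?thesis using assms by (simp add: parallel_class_def)
qed

datatype 'a extended = Infinity bool | Finite 'a

text \<open>The pairs that the triples \<open>A\<close> leave uncovered form two perfect matchings of \<open>G - {z}\<close>,
  given by the involutions \<open>N True\<close> and \<open>N False\<close>. Each matching is joined to one point at
  infinity, and \<open>z\<close> goes with both.\<close>
lemma steiner_triple_system_two_infinities:
  fixes G :: "'a set" and N :: "bool \<Rightarrow> 'a \<Rightarrow> 'a"
  assumes G: "finite G" "z \<in> G"
    and N: "\<And>c x. x \<in> G - {z} \<Longrightarrow> N c x \<in> G - {z} \<and> N c x \<noteq> x \<and> N c (N c x) = x"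
    and N_distinct: "\<And>x. x \<in> G - {z} \<Longrightarrow> N True x \<noteq> N False x"
    and A: "\<And>T. T \<in> A \<Longrightarrow> T \<subseteq> G \<and> card T = 3"
    and uncovered: "\<And>c x T. \<lbrakk>x \<in> G - {z}; T \<in> A; x \<in> T\<rbrakk> \<Longrightarrow> N c x \<notin> T"
    and covered: "\<And>x y. \<lbrakk>x \<in> G; y \<in> G; x \<noteq> y; x = z \<or> y = z \<or> (\<forall>c. y \<noteq> N c x)\<rbrakk> \<Longrightarrow>
      \<exists>!T. T \<in> A \<and> x \<in> T \<and> y \<in> T"
  defines "V \<equiv> range Infinity \<union> Finite ` G"
  defines "B \<equiv> {{Infinity True, Infinity False, Finite z}} \<union>
     (\<lambda>(c, x). {Infinity c, Finite x, Finite (N c x)}) ` (UNIV \<times> (G - {z})) \<union> (`) Finite ` A"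
  shows "steiner_triple_system (card G + 2) V B"
  unfolding steiner_triple_system_def
proof (intro conjI ballI impI)
  show "finite V" using G by (simp add: V_def)
  have "card V = card (range (Infinity :: bool \<Rightarrow> 'a extended)) + card (Finite ` G)"
    unfolding V_def using G by (intro card_Un_disjoint) auto
  also have "\<dots> = card G + 2" by (subst (1 2) card_image) (auto simp: inj_on_def)
  finally show "card V = card G + 2" .
  have block: "T \<subseteq> V \<and> card T = 3" if "T \<in> B" for T
  proof -
    from that consider "T = {Infinity True, Infinity False, Finite z}"
    | c x where "x \<in> G - {z}" "T = {Infinity c, Finite x, Finite (N c x)}"
    | T' where "T' \<in> A" "T = Finite ` T'"
      by (auto simp: B_def)
    then show ?thesis
    proof cases
      case 2
      have "N c x \<in> G" "N c x \<noteq> x" using N[OF 2(1), of c] by auto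
      then show ?thesis using 2 by (auto simp: V_def)
    next
      case 3
      then show ?thesis using A[of T'] by (auto simp: V_def card_image inj_on_def)
    qed (use G in \<open>auto simp: V_def\<close>)
  qed
  show "T \<subseteq> V" "card T = 3" if "T \<in> B" for T using block[OF that] by auto
next
  have inf_inf: "T = {Infinity True, Infinity False, Finite z}"
    if "T \<in> B" "Infinity c \<in> T" "Infinity d \<in> T" "c \<noteq> d" for T c d
    using that by (auto simp: B_def)
  have inf_z: "T = {Infinity True, Infinity False, Finite z}"
    if "T \<in> B" "Infinity c \<in> T" "Finite z \<in> T" for T c
    using that N by (auto simp: B_def)
  have inf_fin: "T = {Infinity c, Finite x, Finite (N c x)}"
    if T: "T \<in> B" "Infinity c \<in> T" "Finite x \<in> T" and x: "x \<in> G - {z}" for T c x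
  proof -
    obtain y where y: "y \<in> G - {z}" "T = {Infinity c, Finite y, Finite (N c y)}"
      using T x by (auto simp: B_def)
    then have "x = y \<or> x = N c y" using T by auto
    then show ?thesis using y N[OF y(1), of c] by auto
  qed
  have fin_fin: "\<exists>!T. T \<in> B \<and> Finite x \<in> T \<and> Finite y \<in> T" if x: "x \<in> G" and y: "y \<in> G" and
      "x \<noteq> y" for x y
  proof (cases "x = z \<or> y = z \<or> (\<forall>c. y \<noteq> N c x)")
    case True
    then obtain T where T: "T \<in> A" "x \<in> T" "y \<in> T" "\<And>T'. \<lbrakk>T' \<in> A; x \<in> T'; y \<in> T'\<rbrakk> \<Longrightarrow> T' = T"
      using covered[OF x y \<open>x \<noteq> y\<close>] by blast
    show ?thesis
    proof (rule ex1I[of _ "Finite ` T"])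
      show "Finite ` T \<in> B \<and> Finite x \<in> Finite ` T \<and> Finite y \<in> Finite ` T"
        using T(1-3) by (simp add: B_def)
      fix U assume U: "U \<in> B \<and> Finite x \<in> U \<and> Finite y \<in> U"
      show "U = Finite ` T"
      proof (cases "U \<in> (`) Finite ` A")
        case True
        then obtain T' where T': "T' \<in> A" "U = Finite ` T'" by blast
        then have "x \<in> T'" "y \<in> T'" using U by auto
        then show ?thesis using T(4) T' by blast
      next
        case False
        then obtain c u where u: "u \<in> G - {z}" "U = {Infinity c, Finite u, Finite (N c u)}"
          using U \<open>x \<noteq> y\<close> by (auto simp: B_def)
        then have "(x = u \<and> y = N c u) \<or> (y = u \<and> x = N c u)" using U \<open>x \<noteq> y\<close> by auto
        then have "y = N c x" "x \<noteq> z" "y \<noteq> z" using N[OF u(1), of c] u(1) by auto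
        then show ?thesis using True by blast
      qed
    qed
  next
    case False
    then obtain c where c: "y = N c x" and xz: "x \<in> G - {z}" "y \<in> G - {z}" using x y by blast
    show ?thesis
    proof (rule ex1I[of _ "{Infinity c, Finite x, Finite y}"])
      show "{Infinity c, Finite x, Finite y} \<in> B \<and> Finite x \<in> {Infinity c, Finite x, Finite y} \<and>
          Finite y \<in> {Infinity c, Finite x, Finite y}"
        using c xz by (auto simp: B_def intro!: image_eqI[of _ _ "(c, x)"])
      fix U assume U: "U \<in> B \<and> Finite x \<in> U \<and> Finite y \<in> U"
      have "U \<notin> (`) Finite ` A" using U uncovered[OF xz(1), of _ c] c by auto
      then obtain d u where u: "u \<in> G - {z}" "U = {Infinity d, Finite u, Finite (N d u)}"
        using U \<open>x \<noteq> y\<close> by (auto simp: B_def)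
      then have "(x = u \<and> y = N d u) \<or> (y = u \<and> x = N d u)" using U \<open>x \<noteq> y\<close> by auto
      then have "y = N d x" "U = {Infinity d, Finite x, Finite y}" using N[OF u(1), of d] u by auto
      moreover have "d = c"
        using N_distinct[OF xz(1)] c calculation(1) by (cases c; cases d) auto
      ultimately show "U = {Infinity c, Finite x, Finite y}" by simp
    qed
  qed
  fix a b assume ab: "a \<in> V" "b \<in> V" "a \<noteq> b"
  have inf_any: "\<exists>!T. T \<in> B \<and> Infinity c \<in> T \<and> b \<in> T" if b: "b \<in> V" "b \<noteq> Infinity c" for b c
  proof -
    have I0: "{Infinity True, Infinity False, Finite z} \<in> B" by (simp add: B_def)
    consider d where "b = Infinity d" "c \<noteq> d" | "b = Finite z" | x where "b = Finite x"
        "x \<in> G - {z}"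
      using b by (auto simp: V_def)
    then show ?thesis
    proof cases
      case (1 d)
      have "Infinity c \<in> {Infinity True, Infinity False, Finite z}" for c by (cases c) simp_all
      then show ?thesis
        using I0 inf_inf[of _ c d] 1 by (intro ex1I[of _
            "{Infinity True, Infinity False, Finite z}"]) blast+
    next
      case 2
      have "Infinity c \<in> {Infinity True, Infinity False, Finite z}" by (cases c) simp_all
      then show ?thesis
        using I0 inf_z[of _ c] 2 by (intro ex1I[of _
            "{Infinity True, Infinity False, Finite z}"]) blast+
    next
      case (3 x)
      then have "{Infinity c, Finite x, Finite (N c x)} \<in> B"
        by (auto simp: B_def intro!: image_eqI[of _ _ "(c, x)"])
      then show ?thesis
        using inf_fin[of _ c x] 3 by (intro ex1I[of _
            "{Infinity c, Finite x, Finite (N c x)}"]) blast+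
    qed
  qed
  show "\<exists>!T. T \<in> B \<and> a \<in> T \<and> b \<in> T"
  proof (cases a)
    case (Infinity c)
    then show ?thesis using inf_any[of b c] ab by auto
  next
    case (Finite x)
    show ?thesis
    proof (cases b)
      case (Infinity c)
      then show ?thesis using inf_any[of a c] ab by (auto simp: conj_commute)
    next
      case (Finite y)
      then show ?thesis using fin_fin[of x y] ab \<open>a = Finite x\<close> by (auto simp: V_def)
    qed
  qed
qed

section \<open>The zero-sum system with switched blocks\<close>

text \<open>The union of \<open>Bp\<close> is the set of breaks. In the cycle of the pairs \<open>{x, f x}\<close>, where \<open>f\<close> is
  the map \<open>step\<close> taking \<open>x\<close> to \<open>x^-2\<close>, the colour of such a pair is \<open>col x\<close>. At a break \<open>b\<close> the
  two triples \<open>{1, b, b^-1}\<close> and \<open>{1, f b, (f b)^-1}\<close> are removed, and the triples \<open>{1, b, f b}\<close>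
  and \<open>{1, b^-1, f (b^-1)}\<close> are added. This leaves uncovered the pairs \<open>{b, b^-1}\<close> and
  \<open>{f b, (f b)^-1}\<close> instead of \<open>{b, f b}\<close> and its inverse: the odd cycle or pair of odd cycles
  becomes one even cycle. The colours of these two new pairs are \<open>True\<close> and \<open>False\<close>, respectively.\<close>
locale switched_zero_sum =
  fixes n :: nat and Bp :: "complex set set" and col :: "complex \<Rightarrow> bool"
  assumes n: "n mod 6 = 1"
    and Bp: "Bp \<subseteq> inverse_pairs n"
    and col_inverse: "x \<in> unity_roots n - {1} \<Longrightarrow> col (inverse x) = col x"
    and break_apart: "b \<in> \<Union>Bp \<Longrightarrow> inverse (b\<^sup>2) \<notin> \<Union>Bp"
    and col_step: "x \<in> unity_roots n - {1} \<Longrightarrow> x \<notin> \<Union>Bp \<Longrightarrow> col (inverse (x\<^sup>2)) \<longleftrightarrow> \<not> col x"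
    and col_break: "b \<in> \<Union>Bp \<Longrightarrow> col b" "b \<in> \<Union>Bp \<Longrightarrow> col (inverse (b\<^sup>2))"
begin

abbreviation "U \<equiv> unity_roots n"
abbreviation "W \<equiv> U - {1}"
abbreviation "Br \<equiv> \<Union>Bp"

definition step :: "complex \<Rightarrow> complex" where "step x = inverse (x\<^sup>2)"
definition back_step :: "complex \<Rightarrow> complex" where "back_step x = inverse x ^ ((n + 1) div 2)"

lemma n_odd: "odd n" and n_pos: "n > 0" and cop: "coprime 2 n" "coprime 3 n"
proof -
  show "odd n" using n by presburger
  then show "coprime 2 n" "n > 0" by (auto intro: odd_pos)
  have "\<not> 3 dvd n" using n by presburger
  then show "coprime 3 n" by (intro prime_imp_coprime) simp_all
qed

lemma Br_W: "b \<in> Br \<Longrightarrow> b \<in> W"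
proof -
  assume "b \<in> Br"
  then obtain S where "S \<in> inverse_pairs n" "b \<in> S" using Bp by blast
  then show "b \<in> W" using unity_roots_closed(4) by (auto simp: inverse_pairs_def)
qed

lemma Br_inverse: "b \<in> Br \<Longrightarrow> inverse b \<in> Br"
proof -
  assume "b \<in> Br"
  then obtain S where S: "S \<in> Bp" "b \<in> S" by blast
  then obtain x where "S = {x, inverse x}" using Bp by (auto simp: inverse_pairs_def)
  then show ?thesis using S by auto
qed

lemma W_nonzero: "x \<in> W \<Longrightarrow> x \<noteq> 0"
  using unity_roots_nonzero n_pos by blast

lemma W_inverse: "x \<in> W \<Longrightarrow> inverse x \<in> W"
  using unity_roots_closed(4) by auto

lemma W_cube: "x \<in> W \<Longrightarrow> x ^ 3 \<noteq> 1" and W_square: "x \<in> W \<Longrightarrow> x\<^sup>2 \<noteq> 1"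
  using unity_roots_coprime_power cop by auto

lemma step_W: "x \<in> W \<Longrightarrow> step x \<in> W"
  using unity_roots_closed(4,5) W_square by (auto simp: step_def)

lemma back_step: "x \<in> U \<Longrightarrow> step (back_step x) = x" "x \<in> U \<Longrightarrow> back_step (step x) = x"
  using unity_roots_half_power[OF _ n_odd] unity_roots_half_power[OF unity_roots_closed(4) n_odd]
  by (auto simp: step_def back_step_def power_inverse)

lemma back_step_W: "x \<in> W \<Longrightarrow> back_step x \<in> W"
proof -
  assume x: "x \<in> W"
  have "back_step x \<in> U" using x unity_roots_closed(4,5) by (auto simp: back_step_def)
  moreover have "back_step x \<noteq> 1" using back_step(1)[of x] x by (auto simp: step_def)
  ultimately show ?thesis by blast
qed

lemma step_neq:
  assumes "x \<in> W"
  shows "inverse x \<noteq> x" "step x \<noteq> x" "step x \<noteq> inverse x" "step (step x) \<noteq> x"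
proof -
  note x0 = W_nonzero[OF assms] and x3 = W_cube[OF assms]
  show "inverse x \<noteq> x" using inverse_neq[OF assms n_odd] .
  show "step x \<noteq> x"
  proof
    assume eq: "step x = x"
    have "x\<^sup>2 * step x = 1" using x0 by (simp add: step_def)
    then have "x ^ 3 = 1" unfolding eq by (simp add: power2_eq_square power3_eq_cube)
    then show False using x3 by blast
  qed
  show "step x \<noteq> inverse x" using x0 assms by (auto simp: step_def power2_eq_square)
  show "step (step x) \<noteq> x"
  proof
    assume "step (step x) = x"
    then have "x * x ^ 3 = x * 1" by (simp add: step_def power_inverse power2_eq_square
        power3_eq_cube mult.assoc)
    then show False using x0 x3 by simp
  qed
qed

lemma step_inj: "\<lbrakk>x \<in> U; y \<in> U; step x = step y\<rbrakk> \<Longrightarrow> x = y"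
  using back_step(2) by metis

lemma step_inverse: "step (inverse x) = inverse (step x)"
  by (simp add: step_def power_inverse)

lemma col_rules:
  "\<lbrakk>x \<in> W; x \<notin> Br\<rbrakk> \<Longrightarrow> col (step x) \<longleftrightarrow> \<not> col x"
  "b \<in> Br \<Longrightarrow> col b" "b \<in> Br \<Longrightarrow> col (step b)" "b \<in> Br \<Longrightarrow> step b \<notin> Br"
  using col_step col_break break_apart by (auto simp: step_def)

text \<open>The matching of colour \<open>c\<close> on the uncovered pairs.\<close>
definition nbr :: "bool \<Rightarrow> complex \<Rightarrow> complex" where
  "nbr c x = (if c then if x \<in> Br then inverse x else if col x then step x else back_step x
     else if back_step x \<in> Br then inverse x else if col x then back_step x else step x)"

text \<open>An edge of the matching is a switched pair of inverse elements, or a pair \<open>{u, step u}\<close> of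
  the right colour outside the breaks. A parallel class sees only the product of the edge, which
  is 1 in the first case, and \<open>u^-1\<close> in the second.\<close>
lemma nbr_edge:
  assumes x: "x \<in> W"
  obtains "nbr c x = inverse x" "if c then x \<in> Br else back_step x \<in> Br"
  | u where "u \<in> W" "u \<notin> Br" "col u = c" "{x, nbr c x} = {u, step u}"
proof (cases "if c then x \<in> Br else back_step x \<in> Br")
  case True
  then show ?thesis using that(1) by (auto simp: nbr_def split: if_splits)
next
  case False
  note b = back_step(1)[of x] back_step_W[OF x]
  show ?thesis
  proof (cases "col x = c")
    case True
    have "x \<notin> Br" using False True col_rules(2)[of x] by (auto split: if_splits)
    moreover have "nbr c x = step x" using False True by (auto simp: nbr_def)
    ultimately show ?thesis using that(2)[of x] x True by auto
  next
    case col: False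
    have "nbr c x = back_step x" using False col by (auto simp: nbr_def)
    moreover have "back_step x \<notin> Br"
      using False col col_rules(3)[of "back_step x"] b x by (auto split: if_splits)
    moreover from this have "col (back_step x) = c"
      using col_rules(1)[of "back_step x"] b x col by auto
    ultimately show ?thesis using that(2)[of "back_step x"] b x by auto
  qed
qed

lemma nbr_involution:
  assumes x: "x \<in> W"
  shows "nbr c x \<in> W" "nbr c x \<noteq> x" "nbr c (nbr c x) = x"
proof -
  have "nbr c x \<in> W \<and> nbr c x \<noteq> x \<and> nbr c (nbr c x) = x"
    using x
  proof (cases rule: nbr_edge[of x c])
    case 1
    have "back_step (inverse x) = inverse (back_step x)" by (simp add: back_step_def power_inverse)
    then have "nbr c (inverse x) = x"
      using 1(2) Br_inverse by (auto simp: nbr_def split: if_splits)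
    then show ?thesis using 1(1) W_inverse[OF x] step_neq(1)[OF x] by simp
  next
    case (2 u)
    have "back_step (step u) = u" using back_step(2) 2 by blast
    moreover have "col (step u) \<longleftrightarrow> \<not> c" using col_rules(1) 2 by blast
    moreover have "step u \<notin> Br" if c using calculation that col_rules(2) by blast
    moreover have "back_step u \<notin> Br" if "\<not> c"
      using that 2 col_rules(3)[of "back_step u"] back_step(1)[of u] by auto
    ultimately have "nbr c u = step u" "nbr c (step u) = u" using 2(2,3) by (auto simp: nbr_def)
    then show ?thesis using 2(1,4) step_W[OF 2(1)] step_neq(2)[OF 2(1)] x
        by (auto simp: doubleton_eq_iff)
  qed
  then show "nbr c x \<in> W" "nbr c x \<noteq> x" "nbr c (nbr c x) = x" by auto
qed

lemma nbr_iff: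
  assumes x: "x \<in> W" and y: "y \<in> W"
  shows "(\<exists>c. y = nbr c x) \<longleftrightarrow>
    (y = step x \<and> x \<notin> Br) \<or> (x = step y \<and> y \<notin> Br) \<or> (y = inverse x \<and> (x \<in> Br \<or> back_step x \<in> Br))"
proof -
  have sy: "x = step y \<longleftrightarrow> y = back_step x" using back_step[of x] back_step[of y] x y by auto
  have br: "x \<notin> Br" if "back_step x \<in> Br" using col_rules(4)[OF that] back_step(1)[of x] x by auto
  have ex: "(\<exists>c. y = nbr c x) \<longleftrightarrow> y = nbr True x \<or> y = nbr False x" by (metis (full_types))
  have "col x" if "x \<in> Br \<or> back_step x \<in> Br"
    using that col_rules(2)[of x] col_rules(3)[of "back_step x"] back_step(1)[of x] x by auto
  then show ?thesis unfolding ex sy nbr_def using br by auto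
qed

lemma nbr_distinct:
  assumes x: "x \<in> W"
  shows "nbr True x \<noteq> nbr False x"
proof -
  have bx: "step (back_step x) = x" "back_step x \<in> W" using back_step(1) back_step_W x by auto
  have "step x \<noteq> back_step x" using step_neq(4)[OF bx(2)] bx step_inj by auto
  moreover have "back_step x \<noteq> inverse x"
  proof
    assume "back_step x = inverse x"
    then have "step (inverse x) = x" using bx by simp
    then have "inverse (step x) = x" by (simp add: step_inverse)
    then show False using step_neq(3)[OF x] by (metis inverse_inverse_eq)
  qed
  moreover have "x \<notin> Br" if "back_step x \<in> Br" using col_rules(4)[OF that] bx by auto
  moreover have "col x" if "x \<in> Br \<or> back_step x \<in> Br"
    using that col_rules(2)[of x] col_rules(3)[of "back_step x"] bx by auto
  ultimately show ?thesis using step_neq(3)[OF x] by (auto simp: nbr_def)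
qed

definition zero_triples :: "complex set set" where
  "zero_triples = {{x, y, inverse (x * y)} | x y. x \<in> U \<and> y \<in> U \<and> x \<noteq> y \<and> x \<noteq> inverse (x * y)
      \<and> y \<noteq> inverse (x * y)}"

definition removed :: "complex set set" where
  "removed = {{1, x, inverse x} | x. x \<in> Br \<or> x \<in> step ` Br}"

definition added :: "complex set set" where
  "added = {{1, b, step b} | b. b \<in> Br}"

definition triples :: "complex set set" where
  "triples = (zero_triples - removed) \<union> added"

lemma zero_triple_through:
  assumes T: "T \<in> zero_triples" "x \<in> T" "y \<in> T" "x \<noteq> y"
  shows "T = {x, y, inverse (x * y)}" "x \<in> U" "y \<in> U" "x \<noteq> inverse (x * y)" "y \<noteq> inverse (x * y)"
proof -
  obtain a b where ab: "a \<in> U" "b \<in> U" "a \<noteq> b" "a \<noteq> inverse (a * b)" "b \<noteq> inverse (a * b)"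
      "T = {a, b, inverse (a * b)}"
    using T(1) by (auto simp: zero_triples_def)
  define c where "c = inverse (a * b)"
  have nz: "a \<noteq> 0" "b \<noteq> 0" using ab unity_roots_nonzero n_pos by auto
  have prods: "inverse (a * b) = c" "inverse (b * a) = c" "inverse (a * c) = b"
      "inverse (c * a) = b"
      "inverse (b * c) = a" "inverse (c * b) = a"
    using nz by (simp_all add: c_def field_simps)
  have cU: "c \<in> U" using ab unity_roots_closed unfolding c_def by blast
  note ab = ab[folded c_def]
  have "(x, y) \<in> {(a, b), (b, a), (a, c), (c, a), (b, c), (c, b)}" using T ab(6) by auto
  then have "T = {x, y, inverse (x * y)} \<and> x \<in> U \<and> y \<in> U \<and> x \<noteq> inverse (x * y)
      \<and> y \<noteq> inverse (x * y)"
    using ab cU prods by (elim insertE emptyE; simp only: prod.inject; elim conjE; simp only:; auto)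
  then show "T = {x, y, inverse (x * y)}" "x \<in> U" "y \<in> U" "x \<noteq> inverse (x * y)"
      "y \<noteq> inverse (x * y)"
    by auto
qed

lemma zero_triples_ex1:
  assumes x: "x \<in> U" and y: "y \<in> U" and "x \<noteq> y"
  shows "{x, y, inverse (x * y)} \<in> zero_triples \<longleftrightarrow> y \<noteq> step x \<and> x \<noteq> step y"
proof -
  have nz: "x \<noteq> 0" "y \<noteq> 0" using assms unity_roots_nonzero n_pos by auto
  have "x = inverse (x * y) \<longleftrightarrow> y = step x" "y = inverse (x * y) \<longleftrightarrow> x = step y"
    using nz by (auto simp: step_def power2_eq_square field_simps)
  moreover have "\<not> (x = inverse (x * y) \<or> y = inverse (x * y))" if
      "{x, y, inverse (x * y)} \<in> zero_triples"
    using zero_triple_through(4,5)[OF that, of x y] \<open>x \<noteq> y\<close> by auto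
  ultimately show ?thesis using assms by (auto simp: zero_triples_def)
qed

lemma added_through:
  assumes "T \<in> added" "x \<in> T" "y \<in> T" "x \<in> W" "y \<in> W" "x \<noteq> y"
  shows "(x \<in> Br \<and> y = step x \<or> y \<in> Br \<and> x = step y) \<and> T = {1, x, y}"
  using assms by (auto simp: added_def)

lemma step_image_Br:
  assumes "x \<in> W"
  shows "x \<in> step ` Br \<longleftrightarrow> back_step x \<in> Br"
proof
  assume "x \<in> step ` Br"
  then obtain b where "b \<in> Br" "x = step b" by blast
  then show "back_step x \<in> Br" using back_step(2)[of b] Br_W by auto
next
  assume "back_step x \<in> Br"
  moreover have "x = step (back_step x)" using back_step(1)[of x] assms by simp
  ultimately show "x \<in> step ` Br" by (rule rev_image_eqI)
qed

lemma removed_through: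
  assumes x: "x \<in> W"
  shows "{1, x, inverse x} \<in> removed \<longleftrightarrow> x \<in> Br \<or> back_step x \<in> Br"
  unfolding step_image_Br[OF x, symmetric]
proof
  assume "{1, x, inverse x} \<in> removed"
  then obtain y where y: "{1, x, inverse x} = {1, y, inverse y}" "y \<in> Br \<or> y \<in> step ` Br"
    unfolding removed_def mem_Collect_eq by (elim exE conjE)
  have "inverse y \<in> Br \<or> inverse y \<in> step ` Br"
    using y(2)
  proof
    assume "y \<in> step ` Br"
    then obtain b where "b \<in> Br" "y = step b" by blast
    then show ?thesis using Br_inverse[of b] step_inverse[of b] by (metis image_eqI)
  qed (use Br_inverse in blast)
  moreover have "x \<in> {1, y, inverse y}" using y(1) by blast
  then have "x = y \<or> x = inverse y" using x by blast
  ultimately show "x \<in> Br \<or> x \<in> step ` Br" using y(2) by blast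
next
  assume "x \<in> Br \<or> x \<in> step ` Br"
  then show "{1, x, inverse x} \<in> removed"
    unfolding removed_def mem_Collect_eq by (intro exI[of _ x] conjI refl)
qed

lemma triple_shape:
  assumes "T \<in> triples"
  shows "T \<subseteq> U \<and> card T = 3"
proof (cases "T \<in> added")
  case True
  then obtain b where "b \<in> Br" "T = {1, b, step b}" by (auto simp: added_def)
  then show ?thesis using Br_W[of b] step_W[of b] step_neq(2)[of b] unity_roots_closed(1) by auto
next
  case False
  then obtain x y where "x \<in> U" "y \<in> U" "x \<noteq> y" "x \<noteq> inverse (x * y)" "y \<noteq> inverse (x * y)"
    "T = {x, y, inverse (x * y)}"
    using assms by (auto simp: triples_def zero_triples_def)
  then show ?thesis using unity_roots_closed(4)[OF unity_roots_closed(2)] by auto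
qed

text \<open>Of the three possible kinds of pair, \<open>{x, step x}\<close> lies in no triple with product 1 and is
  covered by an added triple exactly at a break; \<open>{x, x^-1}\<close> loses its triple exactly at the
  removed ones; every other pair keeps its triple.\<close>
lemma triples_cover:
  assumes x: "x \<in> W" and y: "y \<in> W" and xy: "x \<noteq> y"
  shows "(\<exists>c. y = nbr c x) \<Longrightarrow> \<not> (\<exists>T\<in>triples. x \<in> T \<and> y \<in> T)"
    and "\<not> (\<exists>c. y = nbr c x) \<Longrightarrow> \<exists>!T. T \<in> triples \<and> x \<in> T \<and> y \<in> T"
proof -
  let ?Z = "{x, y, inverse (x * y)}"
  have U: "x \<in> U" "y \<in> U" and x0: "x \<noteq> 0" "y \<noteq> 0" using x y W_nonzero by auto
  have Zrem: "?Z \<in> removed \<longleftrightarrow> y = inverse x \<and> (x \<in> Br \<or> back_step x \<in> Br)"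
  proof
    assume "?Z \<in> removed"
    then obtain u where "?Z = {1, u, inverse u}"
      unfolding removed_def mem_Collect_eq by (elim exE conjE)
    then have "1 \<in> ?Z" by (simp only: insertI1)
    then have "inverse (x * y) = 1" using x y by auto
    then have "x * y = 1" by (rule inverse_eq_1_iff[THEN iffD1])
    then have "y = inverse x" by (simp add: inverse_unique)
    moreover from this have "?Z = {1, x, inverse x}" using \<open>x * y = 1\<close> by auto
    ultimately show "y = inverse x \<and> (x \<in> Br \<or> back_step x \<in> Br)"
      using removed_through[OF x] \<open>?Z \<in> removed\<close> by simp
  next
    assume R: "y = inverse x \<and> (x \<in> Br \<or> back_step x \<in> Br)"
    then have "?Z = {1, x, inverse x}" using x0 by auto
    then show "?Z \<in> removed" using removed_through[OF x] R by simp
  qed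
  have through: "T \<in> triples \<and> x \<in> T \<and> y \<in> T \<longleftrightarrow>
     (T = ?Z \<and> y \<noteq> step x \<and> x \<noteq> step y \<and> \<not> (y = inverse x \<and> (x \<in> Br \<or> back_step x \<in> Br)))
     \<or> (T = {1, x, y} \<and> (x \<in> Br \<and> y = step x \<or> y \<in> Br \<and> x = step y))" (is "?l T \<longleftrightarrow> ?r1 T \<or> ?r2 T")
         for T
  proof
    assume l: "?l T"
    show "?r1 T \<or> ?r2 T"
    proof (cases "T \<in> added")
      case True
      then show ?thesis using added_through[of T x y] l x y xy by blast
    next
      case False
      then have "T \<in> zero_triples" "T \<notin> removed" using l by (auto simp: triples_def)
      then have "T = ?Z" using zero_triple_through(1)[of T x y] l xy by blast
      then show ?thesis
        using zero_triples_ex1[OF U xy] Zrem \<open>T \<in> zero_triples\<close> \<open>T \<notin> removed\<close> by blast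
    qed
  next
    assume "?r1 T \<or> ?r2 T"
    then show "?l T"
    proof
      assume "?r1 T"
      then have "T \<in> zero_triples" "T \<notin> removed" "x \<in> T" "y \<in> T"
        using zero_triples_ex1[OF U xy] Zrem by blast+
      then show "?l T" by (simp add: triples_def)
    next
      assume "?r2 T"
      then have "T \<in> added" "x \<in> T" "y \<in> T" by (auto simp: added_def insert_commute)
      then show "?l T" by (simp add: triples_def)
    qed
  qed
  \<comment> \<open>The pair lies in a remaining triple with product 1 (a) or in an added one (c).\<close>
  define a where "a \<longleftrightarrow> y \<noteq> step x \<and> x \<noteq> step y \<and> \<not> (y = inverse x \<and> (x \<in> Br \<or> back_step x \<in> Br))"
  define c where "c \<longleftrightarrow> x \<in> Br \<and> y = step x \<or> y \<in> Br \<and> x = step y"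
  have "y \<noteq> inverse x" if "y = step x" using step_neq(3)[OF x] that by auto
  moreover have "y \<noteq> inverse x" if "x = step y" using step_neq(3)[OF y] that
      by (metis inverse_inverse_eq)
  moreover have "x \<noteq> step y" if "y = step x" using step_neq(4)[OF x] that by auto
  ultimately have edge: "(\<exists>c. y = nbr c x) \<longleftrightarrow> \<not> a \<and> \<not> c" and "\<not> (a \<and> c)"
    unfolding nbr_iff[OF x y] a_def c_def by argo+
  moreover have "T \<in> triples \<and> x \<in> T \<and> y \<in> T \<longleftrightarrow> (T = ?Z \<and> a) \<or> (T = {1, x, y} \<and> c)" for T
    unfolding a_def c_def by (rule through)
  ultimately show "(\<exists>c. y = nbr c x) \<Longrightarrow> \<not> (\<exists>T\<in>triples. x \<in> T \<and> y \<in> T)"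
    and "\<not> (\<exists>c. y = nbr c x) \<Longrightarrow> \<exists>!T. T \<in> triples \<and> x \<in> T \<and> y \<in> T"
    unfolding edge Bex_def by (simp, cases a, simp_all)
qed

lemma triples_cover_1:
  assumes x: "x \<in> W"
  shows "\<exists>!T. T \<in> triples \<and> 1 \<in> T \<and> x \<in> T"
proof -
  let ?Z = "{1, x, inverse x}"
  have xU: "x \<in> U" "1 \<in> U" "1 \<noteq> x" using x unity_roots_closed(1) by auto
  have Z: "?Z \<in> zero_triples"
    using zero_triples_ex1[OF xU(2,1,3)] step_W[OF x] x by (auto simp: step_def)
  have bx: "step (back_step x) = x" using back_step(1) xU by blast
  have apart: "x \<notin> Br" if "back_step x \<in> Br" using col_rules(4)[OF that] bx by auto
  have added1: "T \<in> added \<and> x \<in> T \<longleftrightarrow>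
     (x \<in> Br \<and> T = {1, x, step x}) \<or> (back_step x \<in> Br \<and> T = {1, back_step x, x})" for T
  proof
    assume "T \<in> added \<and> x \<in> T"
    then obtain b where b: "b \<in> Br" "T = {1, b, step b}" and "x \<in> T"
      unfolding added_def mem_Collect_eq by (elim exE conjE)
    have "x = b \<or> x = step b" using \<open>x \<in> T\<close> xU(3) unfolding b(2) by blast
    then show "(x \<in> Br \<and> T = {1, x, step x}) \<or> (back_step x \<in> Br \<and> T = {1, back_step x, x})"
    proof
      assume "x = b"
      then show ?thesis using b by blast
    next
      assume "x = step b"
      moreover from this have "back_step x = b" using back_step(2) Br_W[OF b(1)] by blast
      ultimately show ?thesis using b by simp
    qed
  next
    assume "(x \<in> Br \<and> T = {1, x, step x}) \<or> (back_step x \<in> Br \<and> T = {1, back_step x, x})"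
    then obtain b where "b \<in> Br" "T = {1, b, step b}" "x \<in> T" using bx by (metis insertI1 insertI2)
    then show "T \<in> added \<and> x \<in> T" unfolding added_def by blast
  qed
  have zero1: "T \<in> zero_triples - removed \<and> 1 \<in> T \<and> x \<in> T \<longleftrightarrow> T = ?Z \<and> \<not> (x \<in> Br
      \<or> back_step x \<in> Br)" for T
  proof
    assume T: "T \<in> zero_triples - removed \<and> 1 \<in> T \<and> x \<in> T"
    then have "T = ?Z" using zero_triple_through(1)[of T 1 x] xU(3) by simp
    then show "T = ?Z \<and> \<not> (x \<in> Br \<or> back_step x \<in> Br)" using T removed_through[OF x] by blast
  next
    assume "T = ?Z \<and> \<not> (x \<in> Br \<or> back_step x \<in> Br)"
    then show "T \<in> zero_triples - removed \<and> 1 \<in> T \<and> x \<in> T" using Z removed_through[OF x] by blast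
  qed
  have "1 \<in> T" if "T \<in> added" for T using that by (auto simp: added_def)
  then have "T \<in> triples \<and> 1 \<in> T \<and> x \<in> T \<longleftrightarrow> (T \<in> zero_triples - removed \<and> 1 \<in> T \<and> x \<in> T)
      \<or> (T \<in> added \<and> x \<in> T)" for T
    unfolding triples_def by blast
  then have "T \<in> triples \<and> 1 \<in> T \<and> x \<in> T \<longleftrightarrow> (T = ?Z \<and> \<not> (x \<in> Br \<or> back_step x \<in> Br)) \<or>
     ((x \<in> Br \<and> T = {1, x, step x}) \<or> (back_step x \<in> Br \<and> T = {1, back_step x, x}))" for T
    unfolding zero1 added1 .
  then show ?thesis using apart by (cases "x \<in> Br"; cases
      "back_step x \<in> Br") (simp_all only: simp_thms ex1_eq)
qed

definition points :: "complex extended set" where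
  "points = range Infinity \<union> Finite ` U"

definition blocks :: "complex extended set set" where
  "blocks = {{Infinity True, Infinity False, Finite 1}} \<union>
     (\<lambda>(c, x). {Infinity c, Finite x, Finite (nbr c x)}) ` (UNIV \<times> W) \<union> (`) Finite ` triples"

lemma sts: "steiner_triple_system (n + 2) points blocks"
proof -
  have "steiner_triple_system (card U + 2) points blocks"
    unfolding points_def blocks_def
  proof (rule steiner_triple_system_two_infinities)
    show "finite U" "1 \<in> U" using unity_roots_finite[OF n_pos] unity_roots_closed(1) by auto
    show "nbr c x \<in> W \<and> nbr c x \<noteq> x \<and> nbr c (nbr c x) = x" if "x \<in> W" for c x
      using nbr_involution[OF that] by auto
    show "nbr True x \<noteq> nbr False x" if "x \<in> W" for x by (rule nbr_distinct[OF that])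
    show "T \<subseteq> U \<and> card T = 3" if "T \<in> triples" for T by (rule triple_shape[OF that])
    show "nbr c x \<notin> T" if "x \<in> W" "T \<in> triples" "x \<in> T" for c x T
      using triples_cover(1)[of x "nbr c x"] nbr_involution[OF that(1), of c] that by metis
    show "\<exists>!T. T \<in> triples \<and> x \<in> T \<and> y \<in> T"
      if xy: "x \<in> U" "y \<in> U" "x \<noteq> y" "x = 1 \<or> y = 1 \<or> (\<forall>c. y \<noteq> nbr c x)" for x y
    proof -
      consider "x = 1" "y \<in> W" | "y = 1" "x \<in> W" | "x \<in> W" "y \<in> W" "\<forall>c. y \<noteq> nbr c x"
        using xy by blast
      then show ?thesis
      proof cases
        case 1
        then show ?thesis using triples_cover_1[of y] by simp
      next
        case 2
        then show ?thesis using triples_cover_1[of x] by (simp add: conj_commute)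
      next
        case 3
        then show ?thesis using triples_cover(2)[OF 3(1,2) \<open>x \<noteq> y\<close>] by blast
      qed
    qed
  qed
  then show ?thesis by (simp add: unity_roots_card[OF n_pos])
qed

text \<open>The block through both points at infinity, the added triples, and the switched pairs joined
  to \<open>Infinity True\<close>: these are 1, at most \<open>2 p\<close> and at most \<open>p\<close> blocks, where \<open>p\<close> is the number
  of odd orbits.\<close>
definition special_blocks :: "complex extended set set" where
  "special_blocks = {{Infinity True, Infinity False, Finite 1}} \<union> (`) Finite ` added
     \<union> (\<lambda>S. insert (Infinity True) (Finite ` S)) ` Bp"

lemma Bp_finite: "finite Bp"
  using Bp unity_roots_finite[OF n_pos] by (auto simp: inverse_pairs_def intro: finite_subset)

lemma card_special_blocks: "finite special_blocks" "card special_blocks \<le> 1 + 3 * card Bp"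
proof -
  have "\<Union>Bp = (\<Union>S\<in>Bp. S)" by simp
  have two: "finite S \<and> card S \<le> 2" if "S \<in> Bp" for S
  proof -
    obtain x where "S = {x, inverse x}" using \<open>S \<in> Bp\<close> Bp by (auto simp: inverse_pairs_def)
    then show ?thesis by (simp add: card_insert_if)
  qed
  have finBr: "finite Br" using Bp_finite two by auto
  have "card Br \<le> (\<Sum>S\<in>Bp. card S)" by (rule card_Union_le_sum_card)
  also have "\<dots> \<le> (\<Sum>S\<in>Bp. 2)" using two by (intro sum_mono) auto
  finally have Br: "card Br \<le> 2 * card Bp" by simp
  have added: "added = (\<lambda>b. {1, b, step b}) ` Br" by (auto simp: added_def)
  let ?I = "{{Infinity True, Infinity False, Finite 1 :: complex extended}}"
  let ?A = "(`) Finite ` added" and ?E = "(\<lambda>S. insert (Infinity True) (Finite ` S)) ` Bp"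
  have "card ?A \<le> card Br" unfolding added image_image by (rule card_image_le[OF finBr])
  moreover have "card ?E \<le> card Bp" by (rule card_image_le[OF Bp_finite])
  moreover have "card (?I \<union> ?A \<union> ?E) \<le> card ?I + card ?A + card ?E"
    by (meson add_le_mono1 card_Un_le order_trans)
  ultimately show "card special_blocks \<le> 1 + 3 * card Bp" using Br by (simp add: special_blocks_def)
  show "finite special_blocks" using finBr Bp_finite by (simp add: special_blocks_def added)
qed

text \<open>Inversion permutes the factors, so the product is its own inverse, and the order of the
  group is odd.\<close>
lemma prod_unity_roots: "\<Prod>U = 1"
proof -
  have fin: "finite U" using unity_roots_finite n_pos by blast
  have "(\<Prod>x\<in>U. x) = (\<Prod>x\<in>U. inverse x)"
    by (rule prod.reindex_bij_witness[of _ inverse inverse]) (auto simp: unity_roots_closed(4))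
  then have "\<Prod>U = inverse (\<Prod>U)" using prod_inversef[of "\<lambda>x. x" U] by (simp add: o_def)
  moreover have "\<Prod>U \<noteq> 0" using fin unity_roots_nonzero n_pos by auto
  ultimately have "(\<Prod>U)\<^sup>2 = 1" by (metis power2_eq_square right_inverse)
  moreover have "\<Prod>U \<in> U" by (simp add: unity_roots_def prod_power_distrib)
  ultimately show ?thesis using unity_roots_coprime_power cop by blast
qed

text \<open>Otherwise all blocks without a point at infinity have product 1, so the edges at the two
  points at infinity have products that multiply to 1. At \<open>Infinity True\<close> the product is \<open>u^-1\<close>
  with \<open>col u\<close>. At \<open>Infinity False\<close> it is either 1, which is impossible because \<open>u\<close> is not 1, or
  \<open>v^-1\<close> for some \<open>v\<close> of the other colour; but then \<open>v\<close> is the inverse of \<open>u\<close> and has the same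
  colour.\<close>
lemma parallel_class_special:
  assumes P: "parallel_class points blocks P"
  shows "P \<inter> special_blocks \<noteq> {}"
proof
  assume none: "P \<inter> special_blocks = {}"
  define w :: "complex extended \<Rightarrow> complex" where "w p = (case p of Infinity _ \<Rightarrow> 1 | Finite x \<Rightarrow> x)"
      for p
  have PB: "P \<subseteq> blocks" and cover: "\<Union>P = points"
    using P by (auto simp: parallel_class_def partial_parallel_class_def)
  have finP: "finite P" using finite_subset[OF PB] steiner_triple_system_finite[OF sts] by blast
  have disj: "T = T'" if "T \<in> P" "T' \<in> P" "p \<in> T" "p \<in> T'" for T T' p
    using P that by (auto simp: parallel_class_def partial_parallel_class_def dest: disjointD)
  have w: "w (Infinity c) = 1" "w (Finite x) = x" for c x by (simp_all add: w_def)
  have at_infinity: "(\<Prod>p\<in>T. w p) = 1 \<and> \<not> c \<or> (\<exists>u\<in>W. col u = c \<and> (\<Prod>p\<in>T. w p) = inverse u)"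
    if T: "T \<in> P" "Infinity c \<in> T" for T c
  proof -
    have "T \<in> blocks" "T \<notin> special_blocks" using T PB none by auto
    then have "T \<noteq> {Infinity True, Infinity False, Finite 1}" "T \<notin> (`) Finite ` triples"
      using T(2) by (auto simp: special_blocks_def)
    then have "T \<in> (\<lambda>(c, x). {Infinity c, Finite x, Finite (nbr c x)}) ` (UNIV \<times> W)"
      using \<open>T \<in> blocks\<close> unfolding blocks_def by blast
    then obtain d x where x: "x \<in> W" "T = {Infinity d, Finite x, Finite (nbr d x)}" by auto
    then have dc: "d = c" using T(2) by auto
    have prod: "(\<Prod>p\<in>T. w p) = x * nbr c x"
      unfolding x(2) dc using nbr_involution(2)[OF x(1), of c] by (simp add: w)
    have x0: "x \<noteq> 0" using W_nonzero[OF x(1)] .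
    show ?thesis
      using x(1)
    proof (cases rule: nbr_edge[of x c])
      case 1
      have "\<not> c"
      proof
        assume c
        then have "x \<in> Br" using 1(2) by simp
        then obtain S where S: "S \<in> Bp" "x \<in> S" by blast
        then have "S = {x, inverse x}" using Bp by (auto simp: inverse_pairs_def)
        then have "T = insert (Infinity True) (Finite ` S)" using x(2) dc \<open>c\<close> 1(1) by simp
        then have "T \<in> special_blocks" using S(1) unfolding special_blocks_def by blast
        then show False using \<open>T \<notin> special_blocks\<close> by blast
      qed
      then show ?thesis using prod 1(1) x0 by simp
    next
      case (2 u)
      have u0: "u \<noteq> 0" using W_nonzero[OF 2(1)] .
      have "x * nbr c x = u * step u" using 2(4) by (auto simp: doubleton_eq_iff mult.commute)
      also have "\<dots> = inverse u" using u0 by (simp add: step_def power2_eq_square)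
      finally show ?thesis using prod 2(1,3) by auto
    qed
  qed
  have finite_block: "(\<Prod>p\<in>T. w p) = 1" if T: "T \<in> P" "\<forall>c. Infinity c \<notin> T" for T
  proof -
    have "T \<in> blocks" "T \<notin> special_blocks" using T PB none by auto
    then have "T \<in> (`) Finite ` triples" using T(2) unfolding blocks_def by auto
    then obtain T' where T': "T' \<in> triples" "T = Finite ` T'" by blast
    then have "T' \<notin> added" using \<open>T \<notin> special_blocks\<close> unfolding special_blocks_def by blast
    then have "T' \<in> zero_triples" using T'(1) unfolding triples_def by blast
    then obtain x y where xy: "x \<in> U" "y \<in> U" "x \<noteq> y" "x \<noteq> inverse (x * y)" "y \<noteq> inverse (x * y)"
      "T' = {x, y, inverse (x * y)}"
      unfolding zero_triples_def mem_Collect_eq by (elim exE conjE)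
    have "(\<Prod>p\<in>T. w p) = (\<Prod>x\<in>T'. x)"
      unfolding T'(2) by (subst prod.reindex) (auto simp: inj_on_def w o_def)
    also have "\<dots> = x * (y * inverse (x * y))" unfolding xy(6) using xy(3-5)
        by (simp del: inverse_mult_distrib)
    also have "\<dots> = 1" using xy(1,2) unity_roots_nonzero[OF _ n_pos] by (simp add: field_simps)
    finally show ?thesis .
  qed
  have "Infinity c \<in> points" for c by (simp add: points_def)
  then obtain T1 T2 where T12: "T1 \<in> P" "Infinity True \<in> T1" "T2 \<in> P" "Infinity False \<in> T2"
    using cover by (metis UnionE)
  have "T1 \<noteq> T2"
  proof
    assume "T1 = T2"
    have "T1 = {Infinity True, Infinity False, Finite 1}"
    proof (rule sts_unique[OF sts, of _ _ "Infinity True" "Infinity False"])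
      show "T1 \<in> blocks" using T12 PB by blast
      show "{Infinity True, Infinity False, Finite 1} \<in> blocks" by (simp add: blocks_def)
    qed (use T12 \<open>T1 = T2\<close> in auto)
    then show False using none T12(1) by (auto simp: special_blocks_def)
  qed
  have rest: "(\<Prod>T\<in>P - {T1, T2}. \<Prod>p\<in>T. w p) = 1"
  proof (rule prod.neutral, rule ballI)
    fix T assume T: "T \<in> P - {T1, T2}"
    have "Infinity True \<notin> T" using disj[of T T1 "Infinity True"] T T12(1,2) by blast
    moreover have "Infinity False \<notin> T" using disj[of T T2 "Infinity False"] T T12(3,4) by blast
    ultimately have "\<forall>c. Infinity c \<notin> T" by (metis (full_types))
    then show "(\<Prod>p\<in>T. w p) = 1" using finite_block T by blast
  qed
  have "1 = (\<Prod>T\<in>P. \<Prod>p\<in>T. w p)"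
  proof -
    have "(\<Prod>p\<in>points. w p) = (\<Prod>p\<in>range Infinity. w p) * (\<Prod>p\<in>Finite ` U. w p)"
      unfolding points_def using unity_roots_finite[OF n_pos] by (intro prod.union_disjoint) auto
    also have "(\<Prod>p\<in>range Infinity. w p) = 1" by (rule prod.neutral) (auto simp: w)
    also have "(\<Prod>p\<in>Finite ` U. w p) = \<Prod>U" by (subst prod.reindex) (auto simp: inj_on_def w o_def)
    finally show ?thesis using prod_unity_roots by (simp only: prod_parallel_class[OF sts P] mult_1)
  qed
  also have "\<dots> = (\<Prod>T\<in>{T1, T2}. \<Prod>p\<in>T. w p) * (\<Prod>T\<in>P - {T1, T2}. \<Prod>p\<in>T. w p)"
    using finP T12 by (subst mult.commute, intro prod.subset_diff) auto
  also have "\<dots> = (\<Prod>p\<in>T1. w p) * (\<Prod>p\<in>T2. w p)" using rest \<open>T1 \<noteq> T2\<close> by simp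
  finally have eq: "(\<Prod>p\<in>T1. w p) * (\<Prod>p\<in>T2. w p) = 1" by simp
  obtain u where u: "u \<in> W" "col u" "(\<Prod>p\<in>T1. w p) = inverse u" using at_infinity[OF T12(1,2)]
      by auto
  have u0: "u \<noteq> 0" using W_nonzero[OF u(1)] .
  from at_infinity[OF T12(3,4)] show False
  proof
    assume "(\<Prod>p\<in>T2. w p) = 1 \<and> \<not> False"
    then show False using eq u by simp
  next
    assume "\<exists>v\<in>W. col v = False \<and> (\<Prod>p\<in>T2. w p) = inverse v"
    then obtain v where v: "v \<in> W" "\<not> col v" "(\<Prod>p\<in>T2. w p) = inverse v" by auto
    then have "v = inverse u" using eq u(3) u0 W_nonzero[OF v(1)] by (simp add: field_simps)
    then show False using v(2) u(2) col_inverse[OF u(1)] by simp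
  qed
qed

lemma high_chromatic_index:
  assumes "18 * card Bp < n - 1"
  shows "\<exists>(V::nat set) B. steiner_triple_system (n + 2) V B
      \<and> real (chromatic_index B) \<ge> (real (n + 2) + 3) / 2"
proof (rule high_chromatic_index_nat[OF sts, of special_blocks 1])
  show "(n + 2) mod 6 = 3" using n by presburger
  show "finite special_blocks" by (rule card_special_blocks)
  show "6 * card special_blocks < 1 * (n + 2 + 3)" using card_special_blocks(2) assms by arith
  fix P assume P: "parallel_class points blocks P"
  have "finite (P \<inter> special_blocks)" using card_special_blocks(1) by simp
  then show "1 \<le> card (P \<inter> special_blocks)"
    using parallel_class_special[OF P] by (simp add: Suc_le_eq card_gt_0_iff)
qed

end

section \<open>The remaining orders\<close>

lemma squaring_inverse_pairs:
  assumes n: "n mod 6 = 1"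
  defines "g \<equiv> (`) (\<lambda>x::complex. x\<^sup>2)"
  shows "inj_on g (inverse_pairs n)" "g ` inverse_pairs n \<subseteq> inverse_pairs n"
    "S \<in> inverse_pairs n \<Longrightarrow> g S \<noteq> S" "(g ^^ h) S = (\<lambda>x. x ^ (2 ^ h)) ` S"
proof -
  have odd: "odd n" using n by presburger
  have n0: "n > 0" using odd by (rule odd_pos)
  have "\<not> 3 dvd n" using n by presburger
  then have cop: "coprime 2 n" "coprime 3 n" using odd by (auto intro: prime_imp_coprime)
  have g: "g {x, inverse x} = {x\<^sup>2, inverse (x\<^sup>2)}" for x by (simp add: g_def power_inverse)
  show "inj_on g (inverse_pairs n)"
  proof (rule inj_onI)
    fix S T assume ST: "S \<in> inverse_pairs n" "T \<in> inverse_pairs n" "g S = g T"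
    then obtain x y where x: "x \<in> unity_roots n" "S = {x, inverse x}" and y: "y \<in> unity_roots n"
        "T = {y, inverse y}"
      by (auto simp: inverse_pairs_def)
    have "x\<^sup>2 \<in> g S" by (simp add: x g)
    then have "x\<^sup>2 = y\<^sup>2 \<or> x\<^sup>2 = (inverse y)\<^sup>2" unfolding ST(3) y(2) g by (simp add: power_inverse)
    then have "x = y \<or> x = inverse y"
      using unity_roots_coprime_power_inj[OF x(1) y(1) n0 _ cop(1)]
        unity_roots_coprime_power_inj[OF x(1) unity_roots_closed(4)[OF y(1)] n0 _ cop(1)] by blast
    then show "S = T" using x y by auto
  qed
  show "g ` inverse_pairs n \<subseteq> inverse_pairs n"
  proof (rule image_subsetI)
    fix S assume "S \<in> inverse_pairs n"
    then obtain x where x: "x \<in> unity_roots n" "x \<noteq> 1" "S = {x, inverse x}"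
        by (auto simp: inverse_pairs_def)
    then have "x\<^sup>2 \<in> unity_roots n - {1}"
      using unity_roots_closed(5)[OF x(1), of 2] unity_roots_coprime_power[OF x(1) _ cop(1)]
          by blast
    then show "g S \<in> inverse_pairs n" unfolding x(3) g inverse_pairs_def by (rule imageI)
  qed
  show "g S \<noteq> S" if S: "S \<in> inverse_pairs n"
  proof
    assume eq: "g S = S"
    obtain x where x: "x \<in> unity_roots n" "x \<noteq> 1" "S = {x, inverse x}"
      using S by (auto simp: inverse_pairs_def)
    have x0: "x \<noteq> 0" using unity_roots_nonzero[OF x(1) n0] .
    have "x\<^sup>2 \<in> {x, inverse x}" using eq unfolding x(3) g by blast
    then have "x * x = x \<or> x ^ 3 = 1" using x0
        by (auto simp: power2_eq_square power3_eq_cube field_simps)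
    then show False using x0 x(2) unity_roots_coprime_power[OF x(1) _ cop(2)] by auto
  qed
  show "(g ^^ h) S = (\<lambda>x. x ^ (2 ^ h)) ` S"
    by (induction h) (simp_all add: g_def image_image flip: power_mult, simp add: mult.commute)
qed

text \<open>The weight of a pair is \<open>1/13\<close>, raised to at least \<open>1/h\<close> if \<open>h\<close>-fold squaring fixes the pair
  for some \<open>h\<close> among 3, 5, 7, 9, 11. Fixed points of shorter odd iterates do not exist, and longer
  odd orbits have length at least 13. The coefficients in \<open>break_count\<close> are \<open>45045 (1/h - 1/13)\<close>
  and, for the constant part, \<open>45045/13\<close>; here 45045 is the least common multiple of 3, 5, 7, 9,
  11 and 13, and the factor 2 in \<open>90090\<close> passes from pairs to elements.\<close>
lemma few_breaks:
  assumes n: "n mod 6 = 1" "n \<notin> {1, 7, 19, 31, 43, 73, 127, 511}"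
  shows "\<exists>Bp \<kappa>. Bp \<subseteq> inverse_pairs n \<and> 18 * card Bp < n - 1 \<and> (\<forall>S\<in>Bp. (\<lambda>x. x\<^sup>2) ` S \<notin> Bp) \<and>
    (\<forall>S\<in>inverse_pairs n. if S \<in> Bp then \<kappa> S \<and> \<kappa> ((\<lambda>x. x\<^sup>2) ` S) else \<kappa> ((\<lambda>x. x\<^sup>2) ` S) \<longleftrightarrow> \<not> \<kappa> S)"
proof -
  have odd: "odd n" using n by presburger
  let ?X = "inverse_pairs n" and ?g = "(`) (\<lambda>x::complex. x\<^sup>2)"
  define fixed where "fixed h = {S \<in> ?X. (?g ^^ h) S = S}" for h
  have finX: "finite ?X"
    using unity_roots_finite[OF odd_pos[OF odd]] by (simp add: inverse_pairs_def)
  have fixed: "2 * card (fixed h) + 2 \<le> gcd (2 ^ h - 1) n + gcd (2 ^ h + 1) n" for h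
    using card_fixed_inverse_pairs[OF odd, of h]
        unfolding fixed_def squaring_inverse_pairs(4)[OF n(1)] .
  define c :: "complex set \<Rightarrow> real" where
    "c S = 1 / 13 + (\<Sum>h\<in>{3, 5, 7, 9, 11}. (1 / real h - 1 / 13) * of_bool (S \<in> fixed h))" for S
  have c_nonneg: "c S \<ge> 1 / 13" for S
  proof -
    have "(\<Sum>h\<in>{3, 5, 7, 9, 11::nat}. (1 / real h - 1 / 13) * of_bool (S \<in> fixed h)) \<ge> 0"
      by (intro sum_nonneg mult_nonneg_nonneg) auto
    then show ?thesis unfolding c_def by linarith
  qed
  have c_odd: "1 / real h \<le> c S" if S: "S \<in> ?X" "odd h" "(?g ^^ h) S = S" for S h
  proof -
    have "h \<noteq> 1"
    proof
      assume "h = 1"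
      then show False using squaring_inverse_pairs(3)[OF n(1) S(1)] S(3)
          by (simp only: funpow.simps One_nat_def o_id)
    qed
    moreover have "h = 1 \<or> h = 3 \<or> h = 5 \<or> h = 7 \<or> h = 9 \<or> h = 11 \<or> h \<ge> 13"
      using S(2) by presburger
    ultimately consider "h \<in> {3, 5, 7, 9, 11}" | "h \<ge> 13" by blast
    then show ?thesis
    proof cases
      case 1
      have "(1 / real h - 1 / 13) * of_bool (S \<in> fixed h) \<le> (\<Sum>h\<in>{3, 5, 7, 9, 11}. (1 / real h - 1
          / 13) * of_bool (S \<in> fixed h))"
        using 1 by (intro member_le_sum) auto
      then show ?thesis using S by (simp add: c_def fixed_def)
    next
      case 2
      then have "1 / real h \<le> 1 / 13" by (simp add: field_simps)
      then show ?thesis using c_nonneg[of S] by linarith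
    qed
  qed
  have "\<exists>B col. B \<subseteq> ?X \<and> real (card B) \<le> (\<Sum>S\<in>?X. c S) \<and> (\<forall>b\<in>B. ?g b \<notin> B) \<and>
    (\<forall>S\<in>?X. if S \<in> B then col S \<and> col (?g S) else col (?g S) \<longleftrightarrow> \<not> col S)"
  proof (rule alternating_colouring_with_breaks[OF finX squaring_inverse_pairs(1,2)[OF n(1)]])
    show "?g S \<noteq> S" if "S \<in> ?X" for S by (rule squaring_inverse_pairs(3)[OF n(1) that])
    show "c S \<ge> 0" if "S \<in> ?X" for S using c_nonneg[of S] by linarith
  qed (rule c_odd)
  then obtain Bp \<kappa> where Bp: "Bp \<subseteq> ?X" "real (card Bp) \<le> (\<Sum>S\<in>?X. c S)" "\<forall>b\<in>Bp. ?g b \<notin> Bp"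
    "\<forall>S\<in>?X. if S \<in> Bp then \<kappa> S \<and> \<kappa> (?g S) else \<kappa> (?g S) \<longleftrightarrow> \<not> \<kappa> S"
    by blast
  have "(\<Sum>S\<in>?X. c S) = (\<Sum>S\<in>?X. 1 / 13) + (\<Sum>h\<in>{3, 5, 7, 9, 11}. \<Sum>S\<in>?X. (1 / real h - 1 / 13) *
      of_bool (S \<in> fixed h))"
    unfolding c_def by (simp only: sum.distrib sum.swap[of _ _ ?X])
  also have "(\<Sum>S\<in>?X. of_bool (S \<in> fixed h)) = real (card (fixed h))" for h
  proof -
    have "?X \<inter> {S. S \<in> fixed h} = fixed h" by (auto simp: fixed_def)
    then show ?thesis using finX by (simp add: of_bool_def sum.If_cases)
  qed
  then have "(\<Sum>h\<in>{3, 5, 7, 9, 11}. \<Sum>S\<in>?X. (1 / real h - 1 / 13) * of_bool (S \<in> fixed h))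
      = (\<Sum>h\<in>{3, 5, 7, 9, 11}. (1 / real h - 1 / 13) * real (card (fixed h)))"
    by (simp only: sum_distrib_left[symmetric])
  finally have "90090 * real (card Bp) \<le> 3465 * real (2 * card ?X) + 11550 * real (2 * card (fixed
      3))
     + 5544 * real (2 * card (fixed 5)) + 2970 * real (2 * card (fixed 7)) + 1540 * real (2 * card
         (fixed 9))
     + 630 * real (2 * card (fixed 11))"
    using Bp(2) by (simp add: field_simps)
  then have "real (90090 * card Bp) \<le> real (3465 * (2 * card ?X) + (11550 * (2 * card (fixed 3))
     + 5544 * (2 * card (fixed 5)) + 2970 * (2 * card (fixed 7)) + 1540 * (2 * card (fixed 9))
     + 630 * (2 * card (fixed 11))))"
    by simp
  then have "90090 * card Bp \<le> 3465 * (2 * card ?X) + (11550 * (2 * card (fixed 3))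
     + 5544 * (2 * card (fixed 5)) + 2970 * (2 * card (fixed 7)) + 1540 * (2 * card (fixed 9))
     + 630 * (2 * card (fixed 11)))"
    by (simp only: of_nat_le_iff)
  also have "\<dots> \<le> 3465 * (n - 1) + (11550 * (gcd 7 n + gcd 9 n - 2) + 5544 * (gcd 31 n + gcd 33 n -
      2)
      + 2970 * (gcd 127 n + gcd 129 n - 2) + 1540 * (gcd 511 n + gcd 513 n - 2)
      + 630 * (gcd 2047 n + gcd 2049 n - 2))"
  proof -
    have le: "2 * card (fixed h) \<le> gcd (2 ^ h - 1) n + gcd (2 ^ h + 1) n - 2" for h
      using fixed[of h] by (rule add_le_imp_le_diff)
    have "2 * card (fixed 3) \<le> gcd 7 n + gcd 9 n - 2" "2 * card (fixed 5) \<le> gcd 31 n + gcd 33 n - 2"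
      "2 * card (fixed 7) \<le> gcd 127 n + gcd 129 n - 2"
          "2 * card (fixed 9) \<le> gcd 511 n + gcd 513 n - 2"
      "2 * card (fixed 11) \<le> gcd 2047 n + gcd 2049 n - 2"
      using le[of 3] le[of 5] le[of 7] le[of 9] le[of 11] by simp_all
    then show ?thesis unfolding card_inverse_pairs[OF odd]
        by (intro add_mono mult_le_mono2 order_refl)
  qed
  finally have "18 * card Bp < n - 1" by (rule break_count[OF n])
  then show ?thesis using Bp by blast
qed

lemma high_chromatic_index_switched:
  assumes n: "n mod 6 = 1" "n \<notin> {1, 7, 19, 31, 43, 73, 127, 511}"
  shows "\<exists>(V::nat set) B. steiner_triple_system (n + 2) V B
      \<and> real (chromatic_index B) \<ge> (real (n + 2) + 3) / 2"
proof -
  obtain Bp \<kappa> where brk: "Bp \<subseteq> inverse_pairs n" "18 * card Bp < n - 1" "\<forall>S\<in>Bp. (\<lambda>x. x\<^sup>2) ` S \<notin> Bp"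
    "\<forall>S\<in>inverse_pairs n. if S \<in> Bp then \<kappa> S \<and> \<kappa> ((\<lambda>x. x\<^sup>2) ` S) else \<kappa> ((\<lambda>x. x\<^sup>2) ` S) \<longleftrightarrow> \<not> \<kappa> S"
    using few_breaks[OF n] by blast
  define col where "col x = \<kappa> {x, inverse x}" for x
  have pair: "{x, inverse x} \<in> inverse_pairs n" if "x \<in> unity_roots n - {1}" for x
    using that by (auto simp: inverse_pairs_def)
  have img: "(\<lambda>x. x\<^sup>2) ` {x, inverse x} = {inverse (x\<^sup>2), inverse (inverse (x\<^sup>2))}" for x :: complex
    by (auto simp: power_inverse)
  have Br: "x \<in> \<Union>Bp \<longleftrightarrow> {x, inverse x} \<in> Bp" for x
  proof
    assume "x \<in> \<Union>Bp"
    then obtain S where S: "S \<in> Bp" "x \<in> S" by blast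
    then obtain y where "S = {y, inverse y}" using brk(1) by (auto simp: inverse_pairs_def)
    then have "S = {x, inverse x}" using S(2) by auto
    then show "{x, inverse x} \<in> Bp" using S(1) by simp
  qed blast
  have Br_W: "x \<in> unity_roots n - {1}" if "x \<in> \<Union>Bp" for x
    using that brk(1) unity_roots_closed(4)[of _ n] by (auto simp: inverse_pairs_def)
  interpret switched_zero_sum n Bp col
  proof
    show "n mod 6 = 1" "Bp \<subseteq> inverse_pairs n" by fact+
    show "col (inverse x) = col x" for x by (simp add: col_def insert_commute)
    show "inverse (b\<^sup>2) \<notin> \<Union>Bp" if "b \<in> \<Union>Bp" for b
      using brk(3) that img[of b] unfolding Br by metis
    show "col (inverse (x\<^sup>2)) \<longleftrightarrow> \<not> col x" if "x \<in> unity_roots n - {1}" "x \<notin> \<Union>Bp" for x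
      using bspec[OF brk(4) pair[OF that(1)]] that(2) unfolding Br col_def img by simp
    show "col b" "col (inverse (b\<^sup>2))" if "b \<in> \<Union>Bp" for b
      using bspec[OF brk(4) pair[OF Br_W[OF that]]] that unfolding Br col_def img by simp_all
  qed
  show ?thesis by (rule high_chromatic_index[OF brk(2)])
qed

theorem theorem1:
  "(\<forall>v::nat. 0 < v \<and> v mod 6 = 3 \<and> v \<notin> {3, 9, 45, 75, 129, 513} \<longrightarrow>
      (\<exists>(V::nat set) B. steiner_triple_system v V B \<and>
          real (chromatic_index B) \<ge> (real v + 3) / 2)) \<and>
   (\<forall>v\<in>{3, 9::nat}. \<not> (\<exists>(V::'a set) B. steiner_triple_system v V B \<and>
          real (chromatic_index B) \<ge> (real v + 3) / 2))"
proof (intro conjI allI impI ballI)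
  fix v :: nat
  assume v: "0 < v \<and> v mod 6 = 3 \<and> v \<notin> {3, 9, 45, 75, 129, 513}"
  consider "v = 21" | "v mod 18 = 15" | "v \<noteq> 21" "v mod 18 \<noteq> 15" by blast
  then show "\<exists>(V::nat set) B. steiner_triple_system v V B
      \<and> real (chromatic_index B) \<ge> (real v + 3) / 2"
  proof cases
    case 1
    show ?thesis unfolding 1 by (rule high_chromatic_index_21)
  next
    case 2
    define k where "k = v div 18"
    have "v = 3 * (6 * k + 5)" using div_mult_mod_eq[of v 18] 2 by (simp add: k_def)
    moreover have "odd (6 * k + 5)" "(6 * k + 5) mod 3 = 2" by presburger+
    ultimately show ?thesis using high_chromatic_index_bose[of "6 * k + 5"] by blast
  next
    case 3
    define n where "n = 6 * (v div 6) + 1"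
    have "v mod 6 = 3" using v by blast
    then have n: "v = n + 2" "n mod 6 = 1" using div_mult_mod_eq[of v 6] by (simp_all add: n_def)
    have "n \<notin> {1, 7, 19, 31, 43, 73, 127, 511}"
    proof
      assume "n \<in> {1, 7, 19, 31, 43, 73, 127, 511}"
      then have "v \<in> {3, 9, 21, 33, 45, 75, 129, 513}" unfolding n(1)
          by (elim insertE emptyE) simp_all
      then show False using 3 v by (elim insertE emptyE) simp_all
    qed
    then show ?thesis unfolding n(1) by (rule high_chromatic_index_switched[OF n(2)])
  qed
next
  fix v :: nat assume "v \<in> {3, 9}"
  then consider "v = 3" | "v = 9" by blast
  then show "\<not> (\<exists>(V::'a set) B. steiner_triple_system v V B
      \<and> real (chromatic_index B) \<ge> (real v + 3) / 2)"
  proof cases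
    case 1
    have "chromatic_index B < 3" if "steiner_triple_system 3 V B" for V :: "'a set" and B
      using chromatic_index_order_3[OF that] by simp
    then show ?thesis unfolding 1 by (auto simp: not_le)
  next
    case 2
    have "chromatic_index B < 6" if "steiner_triple_system 9 V B" for V :: "'a set" and B
      using chromatic_index_order_9[OF that] by simp
    then show ?thesis unfolding 2 by (auto simp: not_le)
  qed
qed

end
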